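(* Let $q$ be a prime power, $n$ a positive integer, $I,J$ positive integers with $I<J<n$, and put $K:=J-I$. Let $\alpha,\beta,\gamma\in\mathbb{F}_{q^n}^*$. Assume that $\gcd(n,I,J)=1$ and that $\alpha\,\gamma^{q^{K}}\beta^{q^{K}+1}$ is not an $A$-th power in $\mathbb{F}_{q^n}$, where $A:=q^{2K}+q^{K}+1$. Then there are infinitely many positive integers $m$ such that $U_{\alpha,\beta,\gamma}^{I,J,nm}$ is a scattered and indecomposable $\mathbb{F}_q$-subspace of $\mathbb{F}_{q^{nm}}^6$.
   Context: For a positive integer $N>J$ and $\alpha,\beta,\gamma\in\mathbb{F}_{q^N}^*$, $$U_{\alpha,\beta,\gamma}^{I,J,N}:=\{(x,y,z,\;x^{q^I}+\alpha y^{q^J},\;x^{q^J}+\beta z^{q^I},\;y^{q^I}+\gamma z^{q^J}) : x,y,z\in\mathbb{F}_{q^N}\}\subseteq\mathbb{F}_{q^N}^6 ;$$ when $N=nm$, elements of $\mathbb{F}_{q^n}$ are regarded as elements of $\mathbb{F}_{q^{nm}}\supseteq\mathbb{F}_{q^n}$. An $\mathbb{F}_q$-subspace $U$ of $\mathbb{F}_{q^N}^6$ is scattered if every one-dimensional $\mathbb{F}_{q^N}$-subspace of $\mathbb{F}_{q^N}^6$ meets $U$ in an $\mathbb{F}_q$-subspace of $\mathbb{F}_q$-dimension at most $1$. For a tuple $\mathcal{F}=(f_1,\ldots,f_s)$ of $q$-linearized polynomials over $\mathbb{F}_{q^N}$ in variables $X_1,\ldots,X_r$ (i.e. $\mathbb{F}_{q^N}$-linear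 combinations of monomials $X_i^{q^j}$, $0\le j<N$), put $U_{\mathcal{F}}:=\{(f_1(x),\ldots,f_s(x)) : x\in\mathbb{F}_{q^N}^r\}\subseteq\mathbb{F}_{q^N}^s$. An $\mathbb{F}_q$-subspace $U$ of a $k$-dimensional $\mathbb{F}_{q^N}$-vector space $V(k,q^N)$ is decomposable if it can be written as $U=U_{\mathcal{F}}\oplus U_{\mathcal{G}}$ for some nonempty tuples $\mathcal{F}$ (of length $s$) and $\mathcal{G}$ (of length $s'$) with $s+s'=k$, where $V(k,q^N)$ is identified with $\mathbb{F}_{q^N}^{s}\oplus\mathbb{F}_{q^N}^{s'}$; in other words, if $V(k,q^N)=V_1\oplus V_2$ for nonzero $\mathbb{F}_{q^N}$-subspaces $V_1,V_2$ such that $U=(U\cap V_1)\oplus(U\cap V_2)$. $U$ is indecomposable if it is not decomposable. An element $c\in\mathbb{F}_{q^n}$ is an $A$-th power in $\mathbb{F}_{q^n}$ if $c=\xi^A$ for some $\xi\in\mathbb{F}_{q^n}$. *)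

theory Defs
  imports
    "HOL-Computational_Algebra.Polynomial"
    "HOL-Computational_Algebra.Primes"
    "HOL-Algebra.AbelCoset"
    "Jordan_Normal_Form.VS_Connect"
begin

text \<open>
  All finite fields of characteristic \<open>p\<close> are taken inside one algebraically closed field
  \<open>'a\<close> of characteristic \<open>p\<close>: for a power \<open>Q\<close> of \<open>p\<close>, the field with \<open>Q\<close> elements is the set of
  roots of \<open>X\<^sup>Q - X\<close>. This makes the inclusion of \<open>GF (q ^ n)\<close> in \<open>GF (q ^ (n * m))\<close> an
  honest inclusion of sets, see \<open>field_GF_ring\<close>, \<open>card_GF\<close> and \<open>GF_mono\<close> below.
\<close>

definition GF :: "nat \<Rightarrow> 'a :: field set" where
  "GF Q = {x. x ^ Q = x}"

definition GF_ring :: "nat \<Rightarrow> 'a :: field ring" where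
  "GF_ring Q = class_ring\<lparr>carrier := GF Q\<rparr>"

definition GF_vec :: "nat \<Rightarrow> nat \<Rightarrow> ('a :: field, 'a vec) module" where
  "GF_vec Q r = (module_vec TYPE('a) r)\<lparr>carrier := {v \<in> carrier_vec r. \<forall>i<r. v $ i \<in> GF Q}\<rparr>"

text \<open>
  Below \<open>F\<close> is the big field, \<open>k\<close> a subfield of it and \<open>V\<close> a vector space over \<open>F\<close>; the same
  record \<open>V\<close> is used as a vector space over \<open>k\<close>.
\<close>

definition scattered ::
  "('a, 'b) ring_scheme \<Rightarrow> ('a, 'b) ring_scheme \<Rightarrow> ('a, 'v, 'c) module_scheme \<Rightarrow> 'v set \<Rightarrow> bool"
where
  "scattered k F V U \<longleftrightarrow>
     VectorSpace.subspace k U V \<and>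
     (\<forall>L. VectorSpace.subspace F L V \<and> vectorspace.dim F (V\<lparr>carrier := L\<rparr>) = 1 \<longrightarrow>
        vectorspace.dim k (V\<lparr>carrier := U \<inter> L\<rparr>) \<le> 1)"

text \<open>
  This is the coordinate-free form of \<open>U = U\<^sub>\<F> \<oplus> U\<^sub>\<G>\<close>: \<open>V1\<close> and \<open>V2\<close> play the role of the two
  coordinate blocks under an identification of \<open>V\<close> with \<open>F\<^sup>s \<oplus> F\<^sup>s\<^sup>'\<close>, where \<open>s, s' > 0\<close>. The sum
  \<open>(U \<inter> V1) + (U \<inter> V2)\<close> is direct because \<open>V1 \<inter> V2\<close> is trivial.
\<close>

definition decomposable ::
  "('a, 'b) ring_scheme \<Rightarrow> ('a, 'v, 'c) module_scheme \<Rightarrow> 'v set \<Rightarrow> bool"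
where
  "decomposable F V U \<longleftrightarrow>
     (\<exists>V1 V2. VectorSpace.subspace F V1 V \<and> VectorSpace.subspace F V2 V \<and>
        V1 \<noteq> {\<zero>\<^bsub>V\<^esub>} \<and> V2 \<noteq> {\<zero>\<^bsub>V\<^esub>} \<and>
        V1 \<inter> V2 = {\<zero>\<^bsub>V\<^esub>} \<and> V1 <+>\<^bsub>V\<^esub> V2 = carrier V \<and>
        (U \<inter> V1) <+>\<^bsub>V\<^esub> (U \<inter> V2) = U)"

abbreviation indecomposable ::
  "('a, 'b) ring_scheme \<Rightarrow> ('a, 'v, 'c) module_scheme \<Rightarrow> 'v set \<Rightarrow> bool"
where
  "indecomposable F V U \<equiv> \<not> decomposable F V U"

definition U_set :: "nat \<Rightarrow> nat \<Rightarrow> nat \<Rightarrow> nat \<Rightarrow> 'a \<Rightarrow> 'a \<Rightarrow> 'a \<Rightarrow> 'a :: field vec set" where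
  "U_set q I J N \<alpha> \<beta> \<gamma> =
     {vec_of_list
        [x, y, z,
         x ^ (q ^ I) + \<alpha> * y ^ (q ^ J),
         x ^ (q ^ J) + \<beta> * z ^ (q ^ I),
         y ^ (q ^ I) + \<gamma> * z ^ (q ^ J)] | x y z.
        x \<in> GF (q ^ N) \<and> y \<in> GF (q ^ N) \<and> z \<in> GF (q ^ N)}"

definition is_power_in :: "'a set \<Rightarrow> nat \<Rightarrow> 'a :: monoid_mult \<Rightarrow> bool" where
  "is_power_in S A c \<longleftrightarrow> (\<exists>\<xi>\<in>S. c = \<xi> ^ A)"


subsection \<open>The ambient structures\<close>

lemma GF_mono: "GF Q \<subseteq> (GF (Q ^ m) :: 'a :: field set)"
proof
  fix x :: 'a assume x: "x \<in> GF Q"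
  have "x ^ (Q ^ m) = x"
    by (induction m) (use x in \<open>simp_all add: GF_def power_mult\<close>)
  thus "x \<in> GF (Q ^ m)"
    by (simp add: GF_def)
qed

context
  fixes p e :: nat
  assumes p: "prime p" "CHAR('a :: field) = p" and e: "e > 0"
begin

lemma GF_pow_add: "(x + y :: 'a) ^ (p ^ e) = x ^ (p ^ e) + y ^ (p ^ e)"
  using p by (auto intro!: freshmans_dream')

lemma zero_in_GF: "0 \<in> (GF (p ^ e) :: 'a set)"
  using p by (simp add: GF_def zero_power prime_gt_0_nat)

lemma one_in_GF: "1 \<in> (GF (p ^ e) :: 'a set)"
  by (simp add: GF_def)

lemma add_in_GF: "x \<in> GF (p ^ e) \<Longrightarrow> y \<in> GF (p ^ e) \<Longrightarrow> x + y \<in> (GF (p ^ e) :: 'a set)"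
  by (simp add: GF_def GF_pow_add)

lemma mult_in_GF: "x \<in> GF (p ^ e) \<Longrightarrow> y \<in> GF (p ^ e) \<Longrightarrow> x * y \<in> (GF (p ^ e) :: 'a set)"
  by (simp add: GF_def power_mult_distrib)

lemma uminus_in_GF: assumes "x \<in> GF (p ^ e)" shows "- x \<in> (GF (p ^ e) :: 'a set)"
proof -
  have "0 = (x + - x) ^ (p ^ e)"
    using p by (simp add: zero_power prime_gt_0_nat)
  also have "\<dots> = x + (- x) ^ (p ^ e)"
    using assms unfolding GF_pow_add by (simp add: GF_def)
  finally have "x + (- x) ^ (p ^ e) = 0"
    by (rule sym)
  thus ?thesis
    by (simp add: GF_def add_eq_0_iff)
qed

lemma inverse_in_GF: "x \<in> GF (p ^ e) \<Longrightarrow> inverse x \<in> (GF (p ^ e) :: 'a set)"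
  by (simp add: GF_def power_inverse)

lemma field_GF_ring: "field (GF_ring (p ^ e) :: 'a ring)"
proof -
  have "cring (GF_ring (p ^ e) :: 'a ring)"
  proof (intro cringI abelian_groupI comm_monoidI)
    fix x assume "x \<in> carrier (GF_ring (p ^ e) :: 'a ring)"
    thus "\<exists>y\<in>carrier (GF_ring (p ^ e)). y \<oplus>\<^bsub>GF_ring (p ^ e)\<^esub> x = \<zero>\<^bsub>GF_ring (p ^ e) :: 'a ring\<^esub>"
      by (intro bexI[of _ "- x"]) (auto simp: GF_ring_def uminus_in_GF)
  qed (auto simp: GF_ring_def zero_in_GF one_in_GF add_in_GF mult_in_GF algebra_simps)
  then interpret cring "GF_ring (p ^ e) :: 'a ring" .
  show ?thesis
  proof (rule cring_fieldI2)
    fix a assume "a \<in> carrier (GF_ring (p ^ e) :: 'a ring)" "a \<noteq> \<zero>\<^bsub>GF_ring (p ^ e)\<^esub>"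
    thus "\<exists>b\<in>carrier (GF_ring (p ^ e)). a \<otimes>\<^bsub>GF_ring (p ^ e)\<^esub> b = \<one>\<^bsub>GF_ring (p ^ e) :: 'a ring\<^esub>"
      by (intro bexI[of _ "inverse a"]) (auto simp: GF_ring_def inverse_in_GF)
  qed (auto simp: GF_ring_def)
qed

end

lemma vectorspace_GF_vec:
  assumes p: "prime p" "CHAR('a :: field) = p" and e: "e > 0" and m: "m > 0"
  shows "vectorspace (GF_ring (p ^ e)) (GF_vec ((p ^ e) ^ m) r :: ('a, 'a vec) module)"
proof -
  have em: "e * m > 0"
    using e m by simp
  have pow: "(p ^ e) ^ m = p ^ (e * m)"
    by (simp add: power_mult)
  define V where "V = (GF_vec ((p ^ e) ^ m) r :: ('a, 'a vec) module)"
  have carrier: "carrier V = {v \<in> carrier_vec r. \<forall>i<r. v $ i \<in> GF (p ^ (e * m))}"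
    by (simp add: V_def GF_vec_def pow)
  have ops [simp]: "\<zero>\<^bsub>V\<^esub> = 0\<^sub>v r" "add V = (+)" "module.smult V = (\<cdot>\<^sub>v)"
    by (simp_all add: V_def GF_vec_def module_vec_def)
  have k [simp]: "carrier (GF_ring (p ^ e)) = (GF (p ^ e) :: 'a set)"
     "\<one>\<^bsub>GF_ring (p ^ e) :: 'a ring\<^esub> = 1" "add (GF_ring (p ^ e) :: 'a ring) = (+)"
     "monoid.mult (GF_ring (p ^ e) :: 'a ring) = (*)"
    by (simp_all add: GF_ring_def)
  have scalar: "c \<in> GF (p ^ (e * m))" if "c \<in> (GF (p ^ e) :: 'a set)" for c
    using GF_mono[of "p ^ e" m] that unfolding pow by blast
  have vec: "v \<in> carrier_vec r" if "v \<in> carrier V" for v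
    using that by (simp add: carrier)
  have uminus: "- v \<in> carrier V" if "v \<in> carrier V" for v
    using that uminus_in_GF[OF p em] by (auto simp: carrier)
  show ?thesis
    unfolding V_def [symmetric]
  proof (rule vs_criteria)
    show "field (GF_ring (p ^ e) :: 'a ring)"
      by (rule field_GF_ring[OF p e])
    show "\<zero>\<^bsub>V\<^esub> \<in> carrier V"
      using zero_in_GF[OF p em] by (simp add: carrier)
    show "\<forall>v w. v \<in> carrier V \<and> w \<in> carrier V \<longrightarrow> v \<oplus>\<^bsub>V\<^esub> w \<in> carrier V"
      using add_in_GF[OF p em] by (auto simp: carrier)
    show "\<forall>v\<in>carrier V. \<exists>w\<in>carrier V. v \<oplus>\<^bsub>V\<^esub> w = \<zero>\<^bsub>V\<^esub>"
    proof
      fix v assume v: "v \<in> carrier V"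
      show "\<exists>w\<in>carrier V. v \<oplus>\<^bsub>V\<^esub> w = \<zero>\<^bsub>V\<^esub>"
        by (rule bexI[OF _ uminus[OF v]]) (use vec[OF v] in simp)
    qed
    show "\<forall>c v. c \<in> carrier (GF_ring (p ^ e)) \<and> v \<in> carrier V \<longrightarrow> c \<odot>\<^bsub>V\<^esub> v \<in> carrier V"
      using mult_in_GF[OF p em] scalar by (auto simp: carrier)
    show "\<forall>v w. v \<in> carrier V \<and> w \<in> carrier V \<longrightarrow> v \<oplus>\<^bsub>V\<^esub> w = w \<oplus>\<^bsub>V\<^esub> v"
      using comm_add_vec vec by (metis ops(2))
  qed (simp_all add: vec smult_add_distrib_vec[of _ r] add_smult_distrib_vec
         smult_smult_assoc assoc_add_vec[of _ r])
qed

lemma card_GF: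
  assumes "prime p" "CHAR('a :: alg_closed_field) = p" "e > 0"
  shows "card (GF (p ^ e) :: 'a set) = p ^ e"
proof -
  define Q where "Q = p ^ e"
  have Q: "Q > 1"
    unfolding Q_def using assms by (intro one_less_power prime_gt_1_nat)
  have Q0: "of_nat Q = (0 :: 'a)"
    unfolding of_nat_eq_0_iff_char_dvd Q_def using assms by (simp add: dvd_power)
  define P :: "'a poly" where "P = monom 1 Q - [:0, 1:]"
  have degP: "degree P = Q"
    unfolding P_def using Q by (simp add: diff_conv_add_uminus degree_add_eq_left degree_monom_eq)
  hence "P \<noteq> 0"
    using Q by auto
  have poly_P: "poly P x = x ^ Q - x" for x
    by (simp add: P_def poly_monom)
  have pderiv_P: "pderiv P = - 1"
    by (simp add: P_def pderiv_diff pderiv_monom Q0 pderiv_pCons one_pCons)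
  obtain A where A: "size A = degree P" "P = Polynomial.smult (lead_coeff P) (\<Prod>x\<in>#A. [:-x, 1:])"
    using alg_closed_imp_factorization[OF \<open>P \<noteq> 0\<close>] by blast
  have roots: "set_mset A = GF Q"
  proof -
    have "x \<in># A \<longleftrightarrow> poly P x = 0" for x
      using \<open>P \<noteq> 0\<close> by (subst A(2)) (auto simp: poly_prod_mset image_iff)
    thus ?thesis
      by (auto simp: GF_def poly_P)
  qed
  have count: "count A x \<le> 1" for x
  proof (rule ccontr)
    assume "\<not> count A x \<le> 1"
    hence "{#x, x#} \<subseteq># A"
      by (auto simp: subseteq_mset_def)
    then obtain B where "A = {#x, x#} + B"
      using mset_subset_eq_exists_conv by blast
    hence "P = [:-x, 1:] * ([:-x, 1:] * Polynomial.smult (lead_coeff P) (\<Prod>x\<in>#B. [:-x, 1:]))"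
      using A(2) by (simp add: mult.assoc)
    then obtain R where "P = [:-x, 1:] * ([:-x, 1:] * R)"
      by blast
    hence "poly (pderiv P) x = 0"
      by (simp add: pderiv_mult del: mult_pCons_left mult_pCons_right)
    thus False
      by (simp add: pderiv_P)
  qed
  have "A = mset_set (set_mset A)"
  proof (rule multiset_eqI)
    fix x
    show "count A x = count (mset_set (set_mset A)) x"
      using count[of x] by (cases "count A x") (auto simp: not_in_iff count_mset_set')
  qed
  hence "card (set_mset A) = Q"
    using A(1) degP by (metis size_mset_set)
  thus ?thesis
    by (simp add: roots Q_def)
qed

end

theory Submission
  imports Defs "Jordan_Normal_Form.Determinant"
begin

text \<open>
  Write \<open>Q = q ^ K\<close>, \<open>N = n * m\<close> and \<open>U = {(v, \<phi> v + \<psi> v)}\<close>, where \<open>\<phi>\<close> collects the terms with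
  exponent \<open>q ^ I\<close> and \<open>\<psi>\<close> those with exponent \<open>q ^ J\<close>. Both obstructions lead to one and the same
  situation, a line stable under the semilinear map \<open>\<phi>\<^sup>-\<^sup>1 \<circ> \<psi>\<close>, that is, \<open>\<psi> v = \<mu> \<phi> v\<close> with \<open>v \<noteq> 0\<close>;
  eliminating coordinates then exhibits \<open>\<alpha> \<gamma>\<^sup>Q \<beta>\<^sup>Q\<^sup>+\<^sup>1\<close> as an \<open>A\<close>-th power in the field with
  \<open>q ^ N\<close> elements. Taking norms, this is impossible as soon as \<open>m\<close> is prime to \<open>A\<close>.

  If \<open>c u\<close> and \<open>u\<close> are nonzero vectors of \<open>U\<close>, such a line appears unless \<open>c\<close> is fixed by the
  powers \<open>q ^ I\<close> and \<open>q ^ J\<close>, hence lies in the field with \<open>q\<close> elements when \<open>m\<close> is prime to \<open>I\<close>.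
  A decomposition of \<open>U\<close> gives an idempotent matrix \<open>P\<close> mapping \<open>U\<close> into itself. Since
  \<open>2 * J < N\<close>, comparing coefficients of \<open>q\<close>-polynomials shows that \<open>P\<close> is block diagonal with
  blocks \<open>X\<close>, \<open>Y\<close> such that \<open>Y \<phi> = \<phi> X\<close> and \<open>Y \<psi> = \<psi> X\<close>. One of the \<open>3 \<times> 3\<close> idempotents
  \<open>X\<close>, \<open>1 - X\<close> has rank at most one, and if that rank is one, its image is a stable line.
\<close>

subsection \<open>Powers and dimensions\<close>

lemma GF_mult_closed: "x \<in> GF Q \<Longrightarrow> y \<in> GF Q \<Longrightarrow> x * y \<in> GF Q"
  by (simp add: GF_def power_mult_distrib)

lemma GF_power_closed: "x \<in> GF Q \<Longrightarrow> x ^ k \<in> GF Q"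
  by (simp add: GF_def) (metis power_mult mult.commute)

lemma carrier_GF_ring [simp]: "carrier (GF_ring Q) = GF Q"
  by (simp add: GF_ring_def)

text \<open>The \<open>k\<close> with \<open>x ^ (q ^ k) = x\<close> are closed under taking
  multiples, so a Bezout relation \<open>i * a = j * b + gcd i j\<close> reaches the gcd. No field
  structure enters.\<close>

lemma fixed_power_gcd:
  fixes x :: "'a :: monoid_mult"
  assumes "x ^ (q ^ i) = x" "x ^ (q ^ j) = x"
  shows "x ^ (q ^ gcd i j) = x"
proof -
  have iter: "x ^ (q ^ (k * l)) = x" if "x ^ (q ^ k) = x" for k l
  proof (induction l)
    case (Suc l)
    have "x ^ (q ^ (k * Suc l)) = (x ^ (q ^ k)) ^ (q ^ (k * l))"
      by (simp add: power_add flip: power_mult)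
    then show ?case using Suc that by simp
  qed simp
  show ?thesis
  proof (cases "i = 0")
    case True
    then show ?thesis using assms by simp
  next
    case False
    then obtain a b where ab: "i * a = j * b + gcd i j"
      using bezout_nat by blast
    have "x = x ^ (q ^ (j * b + gcd i j))"
      using iter[OF assms(1), of a] ab by simp
    also have "\<dots> = (x ^ (q ^ (j * b))) ^ (q ^ gcd i j)"
      by (simp add: power_add flip: power_mult)
    also have "\<dots> = x ^ (q ^ gcd i j)"
      using iter[OF assms(2)] by simp
    finally show ?thesis by simp
  qed
qed

text \<open>The norm down to \<open>GF Q\<close> of an \<open>A\<close>-th root of \<open>c\<close>
  is an \<open>A\<close>-th root of \<open>c ^ m\<close>. As \<open>m\<close> is prime to
  \<open>A\<close>, \<open>c\<close> is a product of powers of \<open>c ^ m\<close> and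
  \<open>c ^ A\<close>, so it would be an \<open>A\<close>-th power already in
  \<open>GF Q\<close>.\<close>

lemma not_is_power_in_extension:
  fixes c :: "'a :: field"
  assumes c: "c \<in> GF Q" "c \<noteq> 0" and m: "coprime m A" "m > 0"
    and no_power: "\<not> is_power_in (GF Q) A c"
  shows "\<not> is_power_in (GF (Q ^ m)) A c"
proof
  assume "is_power_in (GF (Q ^ m)) A c"
  then obtain \<xi> where \<xi>: "\<xi> ^ (Q ^ m) = \<xi>" "c = \<xi> ^ A"
    by (auto simp: is_power_in_def GF_def)
  have c_pow: "c ^ (Q ^ i) = c" for i
    using GF_mono[of Q i] c by (auto simp: GF_def)
  \<comment> \<open>The norm of \<open>\<xi>\<close>. Raising to the power \<open>Q\<close> permutes
    its factors cyclically because \<open>\<xi> ^ (Q ^ m) = \<xi>\<close>.\<close>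
  define \<eta> where "\<eta> = (\<Prod>i<m. \<xi> ^ (Q ^ i))"
  have "\<eta> ^ Q = (\<Prod>i<m. \<xi> ^ (Q ^ Suc i))"
    by (simp add: \<eta>_def prod_power_distrib mult.commute flip: power_mult)
  also have "\<dots> = \<eta>"
  proof -
    obtain l where l: "m = Suc l" using m(2) by (cases m) auto
    have "(\<Prod>i<m. \<xi> ^ (Q ^ Suc i)) = (\<Prod>i<l. \<xi> ^ (Q ^ Suc i)) * \<xi>"
      using \<xi>(1) by (simp add: l)
    also have "\<dots> = \<eta>"
      by (simp only: \<eta>_def l prod.lessThan_Suc_shift) (simp add: mult.commute)
    finally show ?thesis .
  qed
  finally have \<eta>: "\<eta> \<in> GF Q" by (simp add: GF_def)
  have \<eta>_A: "\<eta> ^ A = c ^ m"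
  proof -
    have "\<eta> ^ A = (\<Prod>i<m. c ^ (Q ^ i))"
      by (simp add: \<eta>_def \<xi>(2) prod_power_distrib mult.commute flip: power_mult)
    then show ?thesis by (simp add: c_pow)
  qed
  obtain a b where ab: "m * a = A * b + 1"
    using bezout_nat[of m A] m by auto
  have "c ^ (m * a) = c ^ (A * b) * c"
    using ab by (simp add: power_add)
  then have "c = c ^ (m * a) / c ^ (A * b)"
    using c(2) by simp
  also have "\<dots> = (\<eta> ^ a / c ^ b) ^ A"
  proof -
    have "c ^ (m * a) = (\<eta> ^ a) ^ A"
      unfolding power_mult \<eta>_A[symmetric] by (simp add: mult.commute flip: power_mult)
    then show ?thesis
      by (simp add: power_divide mult.commute flip: power_mult)
  qed
  finally have "c = (\<eta> ^ a / c ^ b) ^ A" .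
  moreover have "(\<eta> ^ a / c ^ b) ^ Q = \<eta> ^ a / c ^ b"
  proof -
    have "(\<eta> ^ a / c ^ b) ^ Q = (\<eta> ^ Q) ^ a / (c ^ Q) ^ b"
      by (simp add: power_divide mult.commute flip: power_mult)
    then show ?thesis using \<eta> c(1) by (simp add: GF_def)
  qed
  ultimately show False
    using no_power by (auto simp: is_power_in_def GF_def)
qed

section \<open>Linear dependence, idempotent matrices, one-dimensional spaces\<close>

text \<open>The \<open>n + 1\<close> vectors become the columns of a square matrix completed by a
  zero row; its determinant vanishes, and a kernel vector gives the coefficients.\<close>

lemma exists_dependency:
  fixes v :: "nat \<Rightarrow> 'a :: field vec"
  assumes v: "\<And>j. j \<le> n \<Longrightarrow> v j \<in> carrier_vec n"
  obtains c where "\<exists>j\<le>n. c j \<noteq> 0" "\<And>i. i < n \<Longrightarrow> (\<Sum>j\<le>n. c j * v j $ i) = 0"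
proof -
  define M where "M = mat (Suc n) (Suc n) (\<lambda>(i, j). if i < n then v j $ i else 0)"
  have M: "M \<in> carrier_mat (Suc n) (Suc n)" by (simp add: M_def)
  have "M = mat\<^sub>r (Suc n) (Suc n) (\<lambda>i. if i = n then 0\<^sub>v (Suc n) else row M i)"
    by (intro eq_matI) (auto simp: M_def)
  moreover have "det \<dots> = 0"
    by (rule det_row_0) (auto simp: M_def)
  ultimately have "det M = 0" by simp
  then obtain c where c: "c \<in> carrier_vec (Suc n)" "c \<noteq> 0\<^sub>v (Suc n)" "M *\<^sub>v c = 0\<^sub>v (Suc n)"
    using det_0_iff_vec_prod_zero_field[OF M] by blast
  show thesis
  proof (rule that[of "vec_index c"])
    show "\<exists>j\<le>n. c $ j \<noteq> 0"
    proof (rule ccontr)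
      assume "\<not> (\<exists>j\<le>n. c $ j \<noteq> 0)"
      then have "c = 0\<^sub>v (Suc n)" using c(1) by (intro eq_vecI) auto
      then show False using c(2) by simp
    qed
  next
    fix i assume i: "i < n"
    have "0 = (M *\<^sub>v c) $ i" using c(3) i by simp
    also have "\<dots> = (\<Sum>j<Suc n. c $ j * v j $ i)"
      using c(1) i by (simp add: M_def scalar_prod_def atLeast0LessThan mult.commute)
    finally show "(\<Sum>j\<le>n. c $ j * v j $ i) = 0" by (simp add: lessThan_Suc_atMost)
  qed
qed

lemma append_vec_smult: "c \<cdot>\<^sub>v (v @\<^sub>v w) = (c \<cdot>\<^sub>v v) @\<^sub>v (c \<cdot>\<^sub>v (w :: 'a :: times vec))"
  by (intro eq_vecI) auto

lemma zero_vec_append: "0\<^sub>v n @\<^sub>v 0\<^sub>v m = (0\<^sub>v (n + m) :: 'a :: zero vec)"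
  by (intro eq_vecI) auto

lemma zero_mat_mult_vec: "w \<in> carrier_vec n \<Longrightarrow> 0\<^sub>m m n *\<^sub>v w = (0\<^sub>v m :: 'a :: semiring_0 vec)"
  by (intro eq_vecI) auto

lemma diff_idempotent:
  fixes X :: "'a :: comm_ring_1 mat"
  assumes X: "X \<in> carrier_mat n n" and idem: "X * X = X"
  shows "(1\<^sub>m n - X) * (1\<^sub>m n - X) = 1\<^sub>m n - X"
proof -
  have "(1\<^sub>m n - X) * (1\<^sub>m n - X) = 1\<^sub>m n * (1\<^sub>m n - X) - X * (1\<^sub>m n - X)"
    using X by (intro minus_mult_distrib_mat[of _ n n]) (auto intro: minus_carrier_mat)
  also have "X * (1\<^sub>m n - X) = X * 1\<^sub>m n - X * X"
    using X by (intro mult_minus_distrib_mat[of _ n n]) auto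
  also have "\<dots> = 0\<^sub>m n n" using X by (simp add: idem)
  finally show ?thesis using X by (auto intro!: eq_matI)
qed

text \<open>
  If both images contained two independent vectors, these four would be independent, as the
  images of \<open>A\<close> and \<open>1 - A\<close> meet trivially.
\<close>
lemma idempotent_3_cases:
  fixes A :: "'a :: field mat"
  assumes A: "A \<in> carrier_mat 3 3" and idem: "A * A = A"
  shows "\<exists>B\<in>{A, 1\<^sub>m 3 - A}. \<forall>v\<in>carrier_vec 3. \<forall>w\<in>carrier_vec 3.
      \<exists>a b. (a \<noteq> 0 \<or> b \<noteq> 0) \<and> a \<cdot>\<^sub>v (B *\<^sub>v v) + b \<cdot>\<^sub>v (B *\<^sub>v w) = 0\<^sub>v 3"
proof (rule ccontr)
  let ?B = "1\<^sub>m 3 - A"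
  assume neg: "\<not> ?thesis"
  obtain v w where vw: "v \<in> carrier_vec 3" "w \<in> carrier_vec 3"
    and indep: "\<And>a b. a \<cdot>\<^sub>v (A *\<^sub>v v) + b \<cdot>\<^sub>v (A *\<^sub>v w) = 0\<^sub>v 3 \<Longrightarrow> a = 0 \<and> b = 0"
    using neg by blast
  obtain v' w' where vw': "v' \<in> carrier_vec 3" "w' \<in> carrier_vec 3"
    and indep': "\<And>a b. a \<cdot>\<^sub>v (?B *\<^sub>v v') + b \<cdot>\<^sub>v (?B *\<^sub>v w') = 0\<^sub>v 3 \<Longrightarrow> a = 0 \<and> b = 0"
    using neg by blast
  define f where "f = (\<lambda>j. [A *\<^sub>v v, A *\<^sub>v w, ?B *\<^sub>v v', ?B *\<^sub>v w'] ! j)"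
  have B: "?B \<in> carrier_mat 3 3" by (rule minus_carrier_mat[OF A])
  have "f j \<in> carrier_vec 3" if "j \<le> 3" for j
  proof -
    have "j = 0 \<or> j = 1 \<or> j = 2 \<or> j = 3" using that by linarith
    then show ?thesis
      using A B vw vw' mult_mat_vec_carrier[of _ 3 3] by (auto simp: f_def)
  qed
  then obtain c where c: "\<exists>j\<le>3. c j \<noteq> 0" "\<And>i. i < 3 \<Longrightarrow> (\<Sum>j\<le>3. c j * f j $ i) = 0"
    using exists_dependency by blast
  let ?x = "c 0 \<cdot>\<^sub>v (A *\<^sub>v v) + c 1 \<cdot>\<^sub>v (A *\<^sub>v w)"
  let ?y = "c 2 \<cdot>\<^sub>v (?B *\<^sub>v v') + c 3 \<cdot>\<^sub>v (?B *\<^sub>v w')"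
  have x: "?x \<in> carrier_vec 3" and y: "?y \<in> carrier_vec 3" 
    using mult_mat_vec_carrier[OF A] mult_mat_vec_carrier[OF B] vw vw' by simp_all
  have sum: "?x + ?y = 0\<^sub>v 3"
  proof (rule eq_vecI)
    fix i assume i: "i < dim_vec (0\<^sub>v 3)"
    then have "(?x + ?y) $ i = (\<Sum>j\<le>3. c j * f j $ i)"
      using A by (simp add: f_def numeral_eq_Suc add.assoc)
    then show "(?x + ?y) $ i = 0\<^sub>v 3 $ i" using c(2) i by simp
  qed (use A in simp)
  \<comment> \<open>\<open>A\<close> is the identity on its own image and kills that of
    \<open>1 - A\<close>, so applying it to \<open>?x + ?y = 0\<close> isolates
    \<open>?x\<close>.\<close>
  have Ax: "A *\<^sub>v (A *\<^sub>v u) = A *\<^sub>v u" if "u \<in> carrier_vec 3" for u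
    using assoc_mult_mat_vec[OF A A that] idem by simp
  have AB: "A *\<^sub>v (?B *\<^sub>v u) = 0\<^sub>v 3" if "u \<in> carrier_vec 3" for u
    using that A Ax[OF that] minus_mult_distrib_mat_vec[OF one_carrier_mat A that]
      mult_minus_distrib_mat_vec[OF A that mult_mat_vec_carrier[OF A that]] by simp
  have "A *\<^sub>v ?x = ?x"
    using A Ax vw by (simp add: mult_add_distrib_mat_vec mult_mat_vec)
  moreover have "c 2 \<cdot>\<^sub>v 0\<^sub>v 3 + c 3 \<cdot>\<^sub>v 0\<^sub>v 3 = 0\<^sub>v 3"
    by (intro eq_vecI) auto
  then have "A *\<^sub>v ?y = 0\<^sub>v 3"
    using A B AB vw' by (simp add: mult_add_distrib_mat_vec[of A 3 3] mult_mat_vec[of A 3 3])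
  ultimately have "?x + 0\<^sub>v 3 = A *\<^sub>v (?x + ?y)"
    using A x y by (simp add: mult_add_distrib_mat_vec[of A 3 3])
  moreover have "A *\<^sub>v 0\<^sub>v 3 = 0\<^sub>v 3" using A by (intro eq_vecI) auto
  ultimately have x0: "?x = 0\<^sub>v 3" using sum x by simp
  then have "?y = 0\<^sub>v 3" using sum y by simp
  then have "c 0 = 0 \<and> c 1 = 0 \<and> c 2 = 0 \<and> c 3 = 0"
    using indep[OF x0] indep'[of "c 2" "c 3"] by simp
  then show False using c(1) by (auto simp: numeral_eq_Suc le_Suc_eq)
qed

lemma dim_le_1_if_generated:
  assumes W: "vectorspace k W" and u_in: "u \<in> carrier W"
    and gen: "\<And>w. w \<in> carrier W \<Longrightarrow> \<exists>c\<in>carrier k. w = c \<odot>\<^bsub>W\<^esub> u"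
  shows "vectorspace.dim k W \<le> 1"
proof -
  interpret W: vectorspace k W by fact
  have u: "{u} \<subseteq> carrier W" using u_in by simp
  have "W.gen_set {u}"
  proof
    show "W.span {u} \<subseteq> carrier W" using W.span_is_subset2[OF u] .
    show "carrier W \<subseteq> W.span {u}"
    proof
      fix w assume "w \<in> carrier W"
      then obtain c where c: "c \<in> carrier k" "w = c \<odot>\<^bsub>W\<^esub> u" using gen by blast
      then have "w = W.lincomb (\<lambda>_. c) {u}" 
        using u_in by (simp add: W.lincomb_def)
      then show "w \<in> W.span {u}"
        using c(1) W.span_def by auto
    qed
  qed
  then show ?thesis using W.gen_ge_dim[of "{u}"] u by simp
qed

lemma dim_1_generator:
  assumes W: "vectorspace K W" and fin: "finite (carrier W)" and dim: "vectorspace.dim K W = 1"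
  obtains u where "u \<in> carrier W" "\<And>w. w \<in> carrier W \<Longrightarrow> \<exists>c\<in>carrier K. w = c \<odot>\<^bsub>W\<^esub> u"
proof -
  interpret W: vectorspace K W by fact
  \<comment> \<open>The finite carrier is itself a generating set, which yields finite dimension and
    hence a basis whose size is \<open>dim\<close>.\<close>
  have "W.gen_set (carrier W)"
    using W.span_is_subset2[of "carrier W"] W.in_own_span[of "carrier W"] by auto
  then have "W.fin_dim" using fin by (auto simp: W.fin_dim_def)
  then obtain B where B: "finite B" "W.basis B" using W.finite_basis_exists by blast
  then have "card B = 1" using W.dim_basis dim by simp
  then obtain u where u: "B = {u}" by (auto simp: card_1_singleton_iff)
  have uW: "u \<in> carrier W" using B u by (simp add: W.basis_def)
  show thesis
  proof (rule that[OF uW])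
    fix w assume "w \<in> carrier W"
    then have "w \<in> W.span {u}" using B u by (simp add: W.basis_def)
    then obtain a where "a \<in> {u} \<rightarrow> carrier K" "W.lincomb a {u} = w"
      using W.finite_in_span[of "{u}" w] uW by auto
    then show "\<exists>c\<in>carrier K. w = c \<odot>\<^bsub>W\<^esub> u"
      using uW by (auto simp: W.lincomb_def intro!: bexI[of _ "a u"])
  qed
qed

text \<open>A nonzero polynomial has at most as many roots as its degree. This turns identities
  between functions on a finite field into identities between coefficients.\<close>

lemma GF_poly_zero:
  fixes g :: "'a :: alg_closed_field poly"
  assumes "prime p" "CHAR('a) = p" "e > 0"
    and zero: "\<And>t. t \<in> GF (p ^ e) \<Longrightarrow> poly g t = 0" and deg: "degree g < p ^ e"
  shows "g = 0"
proof (rule ccontr)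
  assume g: "g \<noteq> 0"
  have "card (GF (p ^ e) :: 'a set) \<le> card {t. poly g t = 0}"
    using zero by (intro card_mono poly_roots_finite g) auto
  also have "\<dots> \<le> degree g"
    by (rule card_poly_roots_bound) (use g in auto)
  finally show False
    using deg card_GF[OF assms(1-3)] by simp
qed

definition vec3 :: "'a \<Rightarrow> 'a \<Rightarrow> 'a \<Rightarrow> 'a vec" where
  "vec3 x y z = vec_of_list [x, y, z]"

lemma vec3_carrier [simp]: "vec3 x y z \<in> carrier_vec 3"
  by (rule carrier_vecI) (simp add: vec3_def)

lemma vec3_index [simp]: "vec3 x y z $ 0 = x" "vec3 x y z $ Suc 0 = y" "vec3 x y z $ 2 = z"
  unfolding vec3_def by (simp_all add: vec_of_list_index del: vec_of_list_Cons)

lemma vec3_append: "vec3 x y z @\<^sub>v vec3 x' y' z' = vec_of_list [x, y, z, x', y', z']"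
  by (simp add: vec3_def)

lemma vec_3_eq_iff:
  fixes v w :: "'a vec"
  assumes "v \<in> carrier_vec 3" "w \<in> carrier_vec 3"
  shows "v = w \<longleftrightarrow> v $ 0 = w $ 0 \<and> v $ 1 = w $ 1 \<and> v $ 2 = w $ 2"
proof -
  have "i < 3 \<longleftrightarrow> i = 0 \<or> i = 1 \<or> i = 2" for i :: nat by linarith
  then show ?thesis using assms by (auto simp: vec_eq_iff)
qed

subsection \<open>Stable lines\<close>

text \<open>\<open>N\<close> stands for \<open>n * m\<close>, and every hypothesis is stated over
  the big field. The bound \<open>2 * J < N\<close> keeps the exponent \<open>q ^ (2 * J)\<close>
  below the size of that field, as comparing coefficients requires.\<close>

locale triple_family =
  fixes p e q N I J K A :: nat and \<alpha> \<beta> \<gamma> :: "'a :: alg_closed_field"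
  assumes p: "prime p" and char_p: "CHAR('a) = p" and e: "e > 0" and q_def: "q = p ^ e"
    and I_pos: "I > 0" and I_less_J: "I < J" and J_less_N: "2 * J < N"
    and gcd_1: "Gcd {N, I, J} = 1"
    and K_def: "K = J - I" and A_def: "A = q ^ (2 * K) + q ^ K + 1"
    and \<alpha>: "\<alpha> \<in> GF (q ^ N)" "\<alpha> \<noteq> 0" and \<beta>: "\<beta> \<in> GF (q ^ N)" "\<beta> \<noteq> 0"
    and \<gamma>: "\<gamma> \<in> GF (q ^ N)" "\<gamma> \<noteq> 0"
    and no_power: "\<not> is_power_in (GF (q ^ N)) A (\<alpha> * \<gamma> ^ (q ^ K) * \<beta> ^ (q ^ K + 1))"
begin

abbreviation F :: "'a set" where "F \<equiv> GF (q ^ N)"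

lemma N_pos: "N > 0"
  using J_less_N by simp

lemma q_power: "q ^ k = p ^ (e * k)"
  by (simp add: q_def power_mult)

lemma q_gt_1: "q > 1"
  unfolding q_def using p e by (intro one_less_power prime_gt_1_nat)

lemma frob_add: "((x :: 'a) + y) ^ (q ^ k) = x ^ (q ^ k) + y ^ (q ^ k)"
  unfolding q_power using p char_p by (auto intro!: freshmans_dream')

lemma frob_diff: "((x :: 'a) - y) ^ (q ^ k) = x ^ (q ^ k) - y ^ (q ^ k)"
  using frob_add[of "x - y" y k] by (simp add: algebra_simps)

lemma frob_inj: "x ^ (q ^ k) = y ^ (q ^ k) \<Longrightarrow> (x :: 'a) = y"
  using frob_diff[of x y k] by simp

lemma zero_frob [simp]: "(0 :: 'a) ^ (q ^ k) = 0"
  using q_gt_1 by (simp add: zero_power)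

lemma F_0 [simp]: "0 \<in> F" and F_1 [simp]: "1 \<in> F"
  by (simp_all add: GF_def)

lemma F_add: "x \<in> F \<Longrightarrow> y \<in> F \<Longrightarrow> x + y \<in> F"
  and F_diff: "x \<in> F \<Longrightarrow> y \<in> F \<Longrightarrow> x - y \<in> F"
  and F_divide: "x \<in> F \<Longrightarrow> y \<in> F \<Longrightarrow> x / y \<in> F"
  by (simp_all add: GF_def frob_add frob_diff power_mult_distrib power_divide)

lemma F_minus: "x \<in> F \<Longrightarrow> - x \<in> F"
  using F_diff[of 0 x] by simp

lemma frob_surj:
  assumes "x \<in> F" obtains y where "y \<in> F" "y ^ (q ^ k) = x"
proof
  \<comment> \<open>\<open>N * k\<close> applications of the \<open>q\<close>-power map are the
    identity on \<open>F\<close>, so \<open>N * k - k\<close> of them invert \<open>k\<close>; since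
    \<open>k \<le> N * k\<close>, the subtraction is not truncated.\<close>
  show "x ^ (q ^ (N * k - k)) \<in> F" by (rule GF_power_closed) fact
  have "k \<le> N * k" using N_pos by simp
  then have "q ^ (N * k - k) * q ^ k = (q ^ N) ^ k"
    by (simp flip: power_add power_mult)
  then have "(x ^ (q ^ (N * k - k))) ^ (q ^ k) = x ^ ((q ^ N) ^ k)"
    by (simp flip: power_mult)
  then show "(x ^ (q ^ (N * k - k))) ^ (q ^ k) = x"
    using GF_mono[of "q ^ N" k] assms by (auto simp: GF_def)
qed

lemma finite_F: "finite F"
  using card_GF[OF p char_p, of "e * N"] e N_pos prime_gt_0_nat[OF p]
  by (intro card_ge_0_finite) (simp add: q_power)

text \<open>
  Eliminating \<open>x\<close> and \<open>y\<close> by means of \<open>J = I + K\<close> leaves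
  \<open>\<mu> ^ A * \<beta> = \<alpha> ^ Q * \<gamma> ^ Q\<^sup>2 * w ^ (Q\<^sup>3 - 1)\<close> where \<open>Q = q ^ K\<close> and \<open>w = z ^ q ^ I\<close>, and
  \<open>Q\<^sup>3 - 1\<close> is a multiple of \<open>A\<close>.
\<close>
lemma no_common_zero:
  assumes F: "x \<in> F" "y \<in> F" "z \<in> F" "\<mu> \<in> F"
    and x: "\<mu> * x ^ (q ^ I) = \<alpha> * y ^ (q ^ J)"
    and y: "\<mu> * y ^ (q ^ I) = \<gamma> * z ^ (q ^ J)"
    and z: "\<beta> * \<mu> * z ^ (q ^ I) = x ^ (q ^ J)"
  shows "x = 0 \<and> y = 0 \<and> z = 0"
proof (rule ccontr)
  assume nz: "\<not> (x = 0 \<and> y = 0 \<and> z = 0)"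
  define Q where "Q = q ^ K"
  have J: "q ^ J = q ^ I * Q"
    using I_less_J by (simp add: Q_def K_def flip: power_add)
  \<comment> \<open>With \<open>\<mu> = 0\<close> each equation makes one coordinate vanish; with
    \<open>\<mu>\<close> nonzero, \<open>z = 0\<close> forces \<open>y = 0\<close> and
    \<open>x = 0\<close>.\<close>
  have "\<mu> \<noteq> 0"
    using nz x y z \<alpha> \<gamma> by auto
  then have z0: "z \<noteq> 0"
    using nz x y z \<alpha> \<beta> \<gamma> by auto
  define w where "w = z ^ (q ^ I)"
  have w: "w \<in> F" "w \<noteq> 0" using F z0 by (auto simp: w_def intro: GF_power_closed)
  \<comment> \<open>Powers \<open>Q\<close> and \<open>Q\<^sup>2\<close> align the exponents so that
    the three equations can be chained.\<close>
  have x': "\<mu> ^ Q * x ^ (q ^ J) = \<alpha> ^ Q * y ^ (q ^ J * Q)"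
    using arg_cong[OF x, of "\<lambda>t. t ^ Q"] by (simp add: J power_mult power_mult_distrib)
  have y': "\<mu> ^ Q\<^sup>2 * y ^ (q ^ J * Q) = \<gamma> ^ Q\<^sup>2 * w ^ Q ^ 3"
    using arg_cong[OF y, of "\<lambda>t. t ^ Q\<^sup>2"]
    by (simp add: J w_def power2_eq_square power3_eq_cube mult.assoc power_mult_distrib flip: power_mult)
  have "\<mu> ^ (Q\<^sup>2 + Q + 1) * \<beta> * w = \<mu> ^ Q\<^sup>2 * (\<mu> ^ Q * x ^ (q ^ J))"
    unfolding z[symmetric] w_def by (simp add: power_add mult_ac)
  also have "\<dots> = \<alpha> ^ Q * \<gamma> ^ Q\<^sup>2 * w ^ Q ^ 3"
    unfolding x' using y' by (simp add: mult_ac)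
  finally have elim: "\<mu> ^ (Q\<^sup>2 + Q + 1) * \<beta> * w = \<alpha> ^ Q * \<gamma> ^ Q\<^sup>2 * w ^ Q ^ 3" .
  have A: "A = Q\<^sup>2 + Q + 1"
    by (simp add: A_def Q_def mult.commute flip: power_mult)
  have "Q > 0" using q_gt_1 by (simp add: Q_def)
  then have cube: "Q ^ 3 = A * (Q - 1) + 1"
    by (cases Q) (simp_all add: A power2_eq_square power3_eq_cube algebra_simps)
  define c where "c = \<alpha> * \<gamma> ^ Q * \<beta> ^ (Q + 1)"
  \<comment> \<open>Multiplying the eliminated equation by \<open>\<beta> ^ A\<close> supplies the
    power of \<open>\<beta>\<close> in \<open>c ^ Q\<close>, with one factor \<open>\<beta>\<close>
    left over to cancel.\<close>
  have "c ^ Q * w ^ (A * (Q - 1)) * (w * \<beta>) = \<alpha> ^ Q * \<gamma> ^ Q\<^sup>2 * w ^ Q ^ 3 * \<beta> ^ A"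
    by (simp add: c_def cube A power_mult_distrib power_add power2_eq_square mult_ac flip: power_mult)
  also have "\<dots> = \<mu> ^ A * \<beta> ^ A * (w * \<beta>)"
    unfolding elim[symmetric] A by simp
  finally have "c ^ Q * (w ^ (Q - 1)) ^ A = (\<mu> * \<beta>) ^ A"
    using w \<beta> by (simp add: power_mult_distrib mult.commute flip: power_mult)
  then have cQ: "c ^ Q = (\<mu> * \<beta> / w ^ (Q - 1)) ^ A"
    using w by (simp add: power_divide field_simps)
  \<comment> \<open>So far only \<open>c ^ Q\<close> is an \<open>A\<close>-th power. Since the
    \<open>Q\<close>-power map is bijective on \<open>F\<close>, a \<open>Q\<close>-th root of the
    base gives the same for \<open>c\<close>.\<close>
  obtain \<xi> where \<xi>: "\<xi> \<in> F" "\<xi> ^ Q = \<mu> * \<beta> / w ^ (Q - 1)"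
    using frob_surj[of "\<mu> * \<beta> / w ^ (Q - 1)" K] F w \<beta>
    by (metis GF_mult_closed GF_power_closed F_divide Q_def)
  have "c ^ Q = (\<xi> ^ A) ^ Q"
    unfolding cQ \<xi>(2)[symmetric] by (simp add: mult.commute flip: power_mult)
  then have "c = \<xi> ^ A" unfolding Q_def by (rule frob_inj)
  then show False
    using no_power \<xi>(1) by (auto simp: is_power_in_def c_def Q_def)
qed

text \<open>The equations say that \<open>u\<close> and \<open>\<kappa> u\<close> both lie in
  \<open>U\<close>. Subtracting leaves relations in the defects \<open>a\<close> and
  \<open>b\<close> of \<open>\<kappa>\<close> under the powers \<open>q ^ I\<close> and
  \<open>q ^ J\<close>; if \<open>b\<close> were nonzero, \<open>- a / b\<close> would be a
  forbidden \<open>\<mu>\<close> for \<open>no_common_zero\<close>. So both defects vanish, and the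
  gcd condition places \<open>\<kappa>\<close> in \<open>GF q\<close>.\<close>

lemma scalar_in_GF_q:
  assumes F: "x \<in> F" "y \<in> F" "z \<in> F" "\<kappa> \<in> F" and nz: "\<not> (x = 0 \<and> y = 0 \<and> z = 0)"
    and eqs: "(\<kappa> * x) ^ (q ^ I) + \<alpha> * (\<kappa> * y) ^ (q ^ J) = \<kappa> * (x ^ (q ^ I) + \<alpha> * y ^ (q ^ J))"
      "(\<kappa> * x) ^ (q ^ J) + \<beta> * (\<kappa> * z) ^ (q ^ I) = \<kappa> * (x ^ (q ^ J) + \<beta> * z ^ (q ^ I))"
      "(\<kappa> * y) ^ (q ^ I) + \<gamma> * (\<kappa> * z) ^ (q ^ J) = \<kappa> * (y ^ (q ^ I) + \<gamma> * z ^ (q ^ J))"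
  shows "\<kappa> \<in> GF q"
proof -
  define a where "a = \<kappa> ^ (q ^ I) - \<kappa>"
  define b where "b = \<kappa> ^ (q ^ J) - \<kappa>"
  have eqs': "a * x ^ (q ^ I) + \<alpha> * (b * y ^ (q ^ J)) = 0"
      "b * x ^ (q ^ J) + \<beta> * (a * z ^ (q ^ I)) = 0"
      "a * y ^ (q ^ I) + \<gamma> * (b * z ^ (q ^ J)) = 0"
    using eqs by (simp_all add: a_def b_def power_mult_distrib algebra_simps)
  have "b = 0"
  proof (rule ccontr)
    assume b: "b \<noteq> 0"
    have "- a / b \<in> F"
      using F by (auto simp: a_def b_def intro!: F_divide F_minus F_diff GF_power_closed)
    moreover have "- a / b * x ^ (q ^ I) = \<alpha> * y ^ (q ^ J)"
        "- a / b * y ^ (q ^ I) = \<gamma> * z ^ (q ^ J)" 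
        "\<beta> * (- a / b) * z ^ (q ^ I) = x ^ (q ^ J)"
      using b eqs' by (simp_all add: field_simps add_eq_0_iff2 add_eq_0_iff)
    ultimately show False using no_common_zero[of x y z "- a / b"] F nz by blast
  qed
  moreover from this have "a = 0"
    using eqs' nz \<beta> by auto
  ultimately have "\<kappa> ^ (q ^ I) = \<kappa>" "\<kappa> ^ (q ^ J) = \<kappa>" "\<kappa> ^ (q ^ N) = \<kappa>"
    using F by (auto simp: a_def b_def GF_def)
  then have "\<kappa> ^ (q ^ gcd N (gcd I J)) = \<kappa>"
    by (intro fixed_power_gcd)
  then show ?thesis using gcd_1 by (simp add: GF_def)
qed

subsection \<open>Idempotents preserving the subspace\<close>

text \<open>Like \<open>\<psi>\<close>, it only permutes, scales and raises coordinates to a power.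
  The order of the entries is the one for which \<open>\<phi> v + \<psi> v\<close> is the lower half
  of a vector of \<open>U\<close>.\<close>

definition \<phi> :: "'a vec \<Rightarrow> 'a vec" where
  "\<phi> v = vec3 ((v $ 0) ^ (q ^ I)) (\<beta> * (v $ 2) ^ (q ^ I)) ((v $ 1) ^ (q ^ I))"

definition \<psi> :: "'a vec \<Rightarrow> 'a vec" where
  "\<psi> v = vec3 (\<alpha> * (v $ 1) ^ (q ^ J)) ((v $ 0) ^ (q ^ J)) (\<gamma> * (v $ 2) ^ (q ^ J))"

definition F3 :: "'a vec set" where
  "F3 = {v \<in> carrier_vec 3. \<forall>i<3. v $ i \<in> F}"

definition U :: "'a vec set" where
  "U = U_set q I J N \<alpha> \<beta> \<gamma>"

lemma \<phi>_carrier [simp]: "\<phi> v \<in> carrier_vec 3" and \<psi>_carrier [simp]: "\<psi> v \<in> carrier_vec 3"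
  by (simp_all add: \<phi>_def \<psi>_def)

lemma \<phi>_dim [simp]: "dim_vec (\<phi> v) = 3" and \<psi>_dim [simp]: "dim_vec (\<psi> v) = 3"
  by (rule carrier_vecD, simp)+

lemma \<phi>_index [simp]:
    "\<phi> v $ 0 = (v $ 0) ^ (q ^ I)" "\<phi> v $ Suc 0 = \<beta> * (v $ 2) ^ (q ^ I)" "\<phi> v $ 2 = (v $ 1) ^ (q ^ I)"
  and \<psi>_index [simp]:
    "\<psi> v $ 0 = \<alpha> * (v $ 1) ^ (q ^ J)" "\<psi> v $ Suc 0 = (v $ 0) ^ (q ^ J)" "\<psi> v $ 2 = \<gamma> * (v $ 2) ^ (q ^ J)"
  by (simp_all add: \<phi>_def \<psi>_def)

lemma F3_carrier: "v \<in> F3 \<Longrightarrow> v \<in> carrier_vec 3"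
  by (simp add: F3_def)

lemma F3_iff: "v \<in> F3 \<longleftrightarrow> v \<in> carrier_vec 3 \<and> v $ 0 \<in> F \<and> v $ 1 \<in> F \<and> v $ 2 \<in> F"
proof -
  have "i < 3 \<longleftrightarrow> i = 0 \<or> i = 1 \<or> i = 2" for i :: nat by linarith
  then show ?thesis by (auto simp: F3_def)
qed

lemma F3_smult: "t \<in> F \<Longrightarrow> v \<in> F3 \<Longrightarrow> t \<cdot>\<^sub>v v \<in> F3"
  by (auto simp: F3_iff GF_mult_closed)

lemma F3_diff: "v \<in> F3 \<Longrightarrow> w \<in> F3 \<Longrightarrow> v - w \<in> F3"
  by (auto simp: F3_iff F_diff)

lemma vec3_in_F3: "x \<in> F \<Longrightarrow> y \<in> F \<Longrightarrow> z \<in> F \<Longrightarrow> vec3 x y z \<in> F3"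
  by (simp add: F3_iff)

lemma \<phi>_smult: "v \<in> carrier_vec 3 \<Longrightarrow> \<phi> (t \<cdot>\<^sub>v v) = t ^ (q ^ I) \<cdot>\<^sub>v \<phi> v"
  by (subst vec_3_eq_iff) (simp_all add: power_mult_distrib mult_ac)

lemma \<psi>_smult: "v \<in> carrier_vec 3 \<Longrightarrow> \<psi> (t \<cdot>\<^sub>v v) = t ^ (q ^ J) \<cdot>\<^sub>v \<psi> v"
  by (subst vec_3_eq_iff) (simp_all add: power_mult_distrib mult_ac)

lemma \<phi>_diff: "v \<in> carrier_vec 3 \<Longrightarrow> w \<in> carrier_vec 3 \<Longrightarrow> \<phi> (v - w) = \<phi> v - \<phi> w"
  by (subst vec_3_eq_iff) (simp_all add: frob_diff right_diff_distrib)

lemma \<psi>_diff: "v \<in> carrier_vec 3 \<Longrightarrow> w \<in> carrier_vec 3 \<Longrightarrow> \<psi> (v - w) = \<psi> v - \<psi> w"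
  by (subst vec_3_eq_iff) (simp_all add: frob_diff right_diff_distrib)

text \<open>Makes \<open>\<phi>\<^sup>-\<^sup>1\<close> available on \<open>F3\<close>: it is used
  to form the semilinear map and to recover \<open>Y\<close> from \<open>X\<close>.\<close>

lemma \<phi>_surj:
  assumes "w \<in> F3" obtains v where "v \<in> F3" "\<phi> v = w"
proof -
  have w: "w \<in> carrier_vec 3" "w $ 0 \<in> F" "w $ 1 / \<beta> \<in> F" "w $ 2 \<in> F"
    using assms \<beta> by (auto simp: F3_iff intro: F_divide)
  obtain x where "x \<in> F" "x ^ (q ^ I) = w $ 0" by (rule frob_surj[OF w(2)])
  moreover obtain z where "z \<in> F" "z ^ (q ^ I) = w $ 1 / \<beta>" by (rule frob_surj[OF w(3)])
  moreover obtain y where "y \<in> F" "y ^ (q ^ I) = w $ 2" by (rule frob_surj[OF w(4)])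
  ultimately show thesis
    using w \<beta> by (intro that[of "vec3 x y z"] vec3_in_F3)
      (simp_all add: vec_3_eq_iff)
qed

lemma \<psi>_in_F3: "v \<in> F3 \<Longrightarrow> \<psi> v \<in> F3"
  using \<alpha> \<gamma> by (auto simp: F3_iff intro: GF_mult_closed GF_power_closed)

lemma U_eq: "U = {v @\<^sub>v (\<phi> v + \<psi> v) | v. v \<in> F3}"
proof -
  have *: "vec_of_list [x, y, z, x ^ (q ^ I) + \<alpha> * y ^ (q ^ J),
         x ^ (q ^ J) + \<beta> * z ^ (q ^ I), y ^ (q ^ I) + \<gamma> * z ^ (q ^ J)] =
      vec3 x y z @\<^sub>v (\<phi> (vec3 x y z) + \<psi> (vec3 x y z))" for x y z
  proof -
    have "\<phi> (vec3 x y z) + \<psi> (vec3 x y z) = vec3 (x ^ (q ^ I) + \<alpha> * y ^ (q ^ J))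
         (x ^ (q ^ J) + \<beta> * z ^ (q ^ I)) (y ^ (q ^ I) + \<gamma> * z ^ (q ^ J))"
      by (simp add: vec_3_eq_iff add.commute)
    then show ?thesis by (simp only: vec3_append)
  qed
  have F3: "v \<in> F3 \<longleftrightarrow> (\<exists>x y z. x \<in> F \<and> y \<in> F \<and> z \<in> F \<and> v = vec3 x y z)" for v
  proof
    assume "v \<in> F3"
    moreover from this have "v = vec3 (v $ 0) (v $ 1) (v $ 2)"
      by (simp add: F3_iff vec_3_eq_iff)
    ultimately show "\<exists>x y z. x \<in> F \<and> y \<in> F \<and> z \<in> F \<and> v = vec3 x y z"
      unfolding F3_iff by blast
  qed (auto intro: vec3_in_F3)
  show ?thesis
    unfolding U_def U_set_def * F3 by blast
qed

section \<open>Comparing coefficients of \<open>q\<close>-polynomials\<close>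

lemma coeff_zero:
  assumes "\<And>t. t \<in> F \<Longrightarrow> poly g t = 0" "degree g < q ^ N"
  shows "coeff g k = 0"
  using GF_poly_zero[OF p char_p, of "e * N" g] assms e N_pos by (simp add: q_power)

lemma degree_monom_less: "k < N \<Longrightarrow> degree (monom (d :: 'a) (q ^ k)) < q ^ N"
  using degree_monom_le[of d "q ^ k"] power_strict_increasing[of k N q] q_gt_1 by linarith

lemma degree_monom_1_less: "degree (monom (d :: 'a) 1) < q ^ N"
  using degree_monom_less[of 0 d] N_pos by simp

text \<open>
  Only the top exponent \<open>q ^ (2 * J)\<close> is safe to compare here, because \<open>q ^ (2 * I)\<close> may coincide
  with \<open>q ^ J\<close>.
\<close>
lemma top_coeff_zero:
  assumes eq: "\<And>t. t \<in> F \<Longrightarrow> l0 * t + l1 * t ^ (q ^ I) + l2 * t ^ (q ^ J) =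
      \<delta> * (a * t + b * t ^ (q ^ I) + c * t ^ (q ^ J)) ^ (q ^ I) +
      \<epsilon> * (a' * t + b' * t ^ (q ^ I) + c' * t ^ (q ^ J)) ^ (q ^ J)"
    and \<epsilon>: "\<epsilon> \<noteq> 0"
  shows "c' = 0"
proof -
  define g where "g = monom l0 1 + monom l1 (q ^ I) + monom l2 (q ^ J)
    - (monom (\<delta> * a ^ (q ^ I)) (q ^ I) + monom (\<delta> * b ^ (q ^ I)) (q ^ (I + I))
      + monom (\<delta> * c ^ (q ^ I)) (q ^ (I + J)))
    - (monom (\<epsilon> * a' ^ (q ^ J)) (q ^ J) + monom (\<epsilon> * b' ^ (q ^ J)) (q ^ (I + J))
      + monom (\<epsilon> * c' ^ (q ^ J)) (q ^ (J + J)))"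
  have "poly g t = 0" if "t \<in> F" for t
  proof -
    have pow: "(t ^ (q ^ i)) ^ (q ^ j) = t ^ (q ^ (i + j))" for i j
      by (simp add: power_add flip: power_mult)
    show ?thesis
      unfolding g_def poly_diff poly_add poly_monom
      using eq[OF that] unfolding frob_add power_mult_distrib pow
      by (simp add: distrib_left add.commute mult.assoc)
  qed
  moreover have "degree g < q ^ N"
  proof -
    show ?thesis
      unfolding g_def using I_less_J J_less_N
      by (intro degree_add_less degree_diff_less degree_monom_less degree_monom_1_less) linarith+
  qed
  ultimately have "coeff g (q ^ (J + J)) = 0" by (rule coeff_zero)
  moreover have "q ^ I \<noteq> q ^ (J + J)" "q ^ J \<noteq> q ^ (J + J)" "q ^ (I + I) \<noteq> q ^ (J + J)"
      "q ^ (I + J) \<noteq> q ^ (J + J)" "1 \<noteq> q ^ (J + J)"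
    using q_gt_1 I_less_J one_less_power[of q "J + J"] by auto
  then have "coeff g (q ^ (J + J)) = - (\<epsilon> * c' ^ (q ^ J))"
    unfolding g_def coeff_diff coeff_add coeff_monom by simp
  ultimately show ?thesis using \<epsilon> by simp
qed

text \<open>The exponents \<open>q ^ 0\<close>, \<open>q ^ I\<close>, \<open>q ^ J\<close> are
  distinct and below \<open>q ^ N\<close>, because \<open>0 < I < J < N\<close>.\<close>

lemma coeffs_eq:
  assumes eq: "\<And>t. t \<in> F \<Longrightarrow> l0 * t + l1 * t ^ (q ^ I) + l2 * t ^ (q ^ J) =
      l1' * t ^ (q ^ I) + l2' * t ^ (q ^ J)"
  shows "l0 = 0" "l1 = l1'" "l2 = l2'"
proof -
  define g where "g = monom l0 1 + monom (l1 - l1') (q ^ I) + monom (l2 - l2') (q ^ J)"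
  have "poly g t = 0" if "t \<in> F" for t
  proof -
    have "poly g t = (l0 * t + l1 * t ^ (q ^ I) + l2 * t ^ (q ^ J)) - (l1' * t ^ (q ^ I) + l2' * t ^ (q ^ J))"
      by (simp add: g_def poly_monom algebra_simps)
    then show ?thesis using eq[OF that] by simp
  qed
  moreover have "degree g < q ^ N"
  proof -
    show ?thesis
      unfolding g_def using I_less_J J_less_N
      by (intro degree_add_less degree_monom_less degree_monom_1_less) linarith+
  qed
  ultimately have *: "coeff g k = 0" for k by (rule coeff_zero)
  have "q ^ I > q ^ 0" "q ^ J > q ^ I"
    using q_gt_1 I_pos I_less_J by (intro power_strict_increasing; simp)+
  then show "l0 = 0" "l1 = l1'" "l2 = l2'"
    using *[of 1] *[of "q ^ I"] *[of "q ^ J"] I_pos I_less_J q_gt_1 by (simp_all add: g_def)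
qed

text \<open>Replacing \<open>v\<close> by \<open>t \<cdot>\<^sub>v v\<close> turns stability into an
  identity of \<open>q\<close>-polynomials in \<open>t\<close>. Its top coefficient gives
  \<open>B (\<psi> v) = 0\<close>, hence \<open>B = 0\<close>; afterwards only the exponents
  \<open>1\<close>, \<open>q ^ I\<close> and \<open>q ^ J\<close> are left, and their coefficients
  give the other claims.\<close>

lemma endomorphism_blocks:
  assumes [simp]: "X \<in> carrier_mat 3 3" "B \<in> carrier_mat 3 3" "C \<in> carrier_mat 3 3" "D \<in> carrier_mat 3 3"
    and stable: "\<And>u. u \<in> U \<Longrightarrow> four_block_mat X B C D *\<^sub>v u \<in> U"
  shows "B = 0\<^sub>m 3 3" "C = 0\<^sub>m 3 3"
    "v \<in> F3 \<Longrightarrow> X *\<^sub>v v \<in> F3"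
    "v \<in> F3 \<Longrightarrow> D *\<^sub>v \<phi> v = \<phi> (X *\<^sub>v v)"
    "v \<in> F3 \<Longrightarrow> D *\<^sub>v \<psi> v = \<psi> (X *\<^sub>v v)"
proof -
  note mv = mult_mat_vec_carrier[of _ 3 3]
  have idx: "(M *\<^sub>v v) $ i = M $$ (i, 0) * v $ 0 + M $$ (i, 1) * v $ 1 + M $$ (i, 2) * v $ 2"
    if "M \<in> carrier_mat 3 3" "v \<in> carrier_vec 3" "i < 3" for M :: "'a mat" and v i
    using that by (simp add: scalar_prod_def numeral_3_eq_3 numeral_2_eq_2)
  \<comment> \<open>A matrix that kills nonzero multiples of all unit vectors is zero. The map
    \<open>f\<close> will be \<open>\<psi>\<close> for \<open>B\<close> and the identity for
    \<open>C\<close>.\<close>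
  have mat_0: "M = 0\<^sub>m 3 3" 
    if M: "M \<in> carrier_mat 3 3" and z: "\<And>v. v \<in> F3 \<Longrightarrow> M *\<^sub>v f v = 0\<^sub>v 3"
      and f: "\<And>i. i < 3 \<Longrightarrow> \<exists>v\<in>F3. \<exists>c. c \<noteq> 0 \<and> f v = c \<cdot>\<^sub>v unit_vec 3 i" for M :: "'a mat" and f
  proof (rule eq_matI)
    fix i j assume ij: "i < dim_row (0\<^sub>m 3 3 :: 'a mat)" "j < dim_col (0\<^sub>m 3 3 :: 'a mat)"
    then obtain v c where v: "v \<in> F3" "c \<noteq> 0" "f v = c \<cdot>\<^sub>v unit_vec 3 j" using f[of j] by auto
    have "0 = (M *\<^sub>v f v) $ i" using z[OF v(1)] ij by simp
    also have "\<dots> = c * M $$ (i, j)"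
      unfolding v(3) using M ij by (simp add: scalar_prod_smult_distrib[of _ 3] scalar_prod_right_unit[of _ 3])
    finally show "M $$ (i, j) = 0\<^sub>m 3 3 $$ (i, j)" using v(2) ij by simp
  qed (use M in auto)
  have image: "X *\<^sub>v v + B *\<^sub>v (\<phi> v + \<psi> v) \<in> F3"
    "C *\<^sub>v v + D *\<^sub>v (\<phi> v + \<psi> v) =
      \<phi> (X *\<^sub>v v + B *\<^sub>v (\<phi> v + \<psi> v)) + \<psi> (X *\<^sub>v v + B *\<^sub>v (\<phi> v + \<psi> v))" (is "?L = \<phi> ?R + _")
    if v: "v \<in> F3" for v
  proof -
    have [simp]: "v \<in> carrier_vec 3" using v by (rule F3_carrier)
    have "four_block_mat X B C D *\<^sub>v (v @\<^sub>v (\<phi> v + \<psi> v)) \<in> U"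
      using v by (intro stable) (auto simp: U_eq)
    also have "four_block_mat X B C D *\<^sub>v (v @\<^sub>v (\<phi> v + \<psi> v)) = ?R @\<^sub>v ?L"
      by (rule four_block_mat_mult_vec[of _ 3 3 _ 3 _ 3]) auto
    finally obtain w where w: "w \<in> F3" "?R @\<^sub>v ?L = w @\<^sub>v (\<phi> w + \<psi> w)"
      unfolding U_eq by blast
    moreover have "?R \<in> carrier_vec 3" by (intro add_carrier_vec mv) auto
    ultimately have "?R = w" "?L = \<phi> w + \<psi> w"
      using append_vec_eq[of ?R 3 w] F3_carrier by blast+
    then show "?R \<in> F3" "?L = \<phi> ?R + \<psi> ?R" using w(1) by simp_all
  qed
  have scaled: "M *\<^sub>v (\<phi> (t \<cdot>\<^sub>v v) + \<psi> (t \<cdot>\<^sub>v v)) = t ^ (q ^ I) \<cdot>\<^sub>v (M *\<^sub>v \<phi> v) + t ^ (q ^ J) \<cdot>\<^sub>v (M *\<^sub>v \<psi> v)"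
    if "M \<in> carrier_mat 3 3" "v \<in> carrier_vec 3" for t and M v
    using that by (simp add: \<phi>_smult \<psi>_smult mult_add_distrib_mat_vec[of M 3 3] mult_mat_vec[of M 3 3])
  have expand: "t \<cdot>\<^sub>v (C *\<^sub>v v) + (t ^ (q ^ I) \<cdot>\<^sub>v (D *\<^sub>v \<phi> v) + t ^ (q ^ J) \<cdot>\<^sub>v (D *\<^sub>v \<psi> v)) =
      \<phi> (t \<cdot>\<^sub>v (X *\<^sub>v v) + (t ^ (q ^ I) \<cdot>\<^sub>v (B *\<^sub>v \<phi> v) + t ^ (q ^ J) \<cdot>\<^sub>v (B *\<^sub>v \<psi> v))) +
      \<psi> (t \<cdot>\<^sub>v (X *\<^sub>v v) + (t ^ (q ^ I) \<cdot>\<^sub>v (B *\<^sub>v \<phi> v) + t ^ (q ^ J) \<cdot>\<^sub>v (B *\<^sub>v \<psi> v)))"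
    if v: "v \<in> F3" and t: "t \<in> F" for v t
    using image(2)[OF F3_smult[OF t v]] F3_carrier[OF v] 
    by (simp add: scaled mult_mat_vec[of _ 3 3])
  define comb where "comb t w0 w1 w2 = t \<cdot>\<^sub>v w0 + (t ^ (q ^ I) \<cdot>\<^sub>v w1 + t ^ (q ^ J) \<cdot>\<^sub>v w2)" for t :: 'a and w0 w1 w2
  have comb_index: "comb t w0 w1 w2 $ i = w0 $ i * t + w1 $ i * t ^ (q ^ I) + w2 $ i * t ^ (q ^ J)"
    if "w0 \<in> carrier_vec 3" "w1 \<in> carrier_vec 3" "w2 \<in> carrier_vec 3" "i < 3" for t w0 w1 w2 i
    using that by (simp add: comb_def mult.commute add.assoc)
  have comb_carrier: "comb t w0 w1 w2 \<in> carrier_vec 3"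
    if "w0 \<in> carrier_vec 3" "w1 \<in> carrier_vec 3" "w2 \<in> carrier_vec 3" for t w0 w1 w2
    using that by (simp add: comb_def)
  have B\<psi>: "B *\<^sub>v \<psi> v = 0\<^sub>v 3" if v: "v \<in> F3" for v
  proof -
    note [simp] = F3_carrier[OF v] mv comb_index comb_carrier
    have "comb t (C *\<^sub>v v) (D *\<^sub>v \<phi> v) (D *\<^sub>v \<psi> v) $ i =
        (\<phi> (comb t (X *\<^sub>v v) (B *\<^sub>v \<phi> v) (B *\<^sub>v \<psi> v)) + \<psi> (comb t (X *\<^sub>v v) (B *\<^sub>v \<phi> v) (B *\<^sub>v \<psi> v))) $ i"
      if "t \<in> F" for t i
      using expand[OF v that] by (simp only: comb_def)
    note eq = this[of _ 0] this[of _ 1] this[of _ 2]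
    \<comment> \<open>Rows \<open>0\<close>, \<open>1\<close>, \<open>2\<close> of
      \<open>\<psi>\<close> read the entries \<open>1\<close>, \<open>0\<close>, \<open>2\<close> of
      the argument, so this is the order in which entries are killed; \<open>\<delta>\<close> and
      \<open>\<epsilon>\<close> are the scalars of \<open>\<phi>\<close> and \<open>\<psi>\<close>
      in the row.\<close>
    have "(B *\<^sub>v \<psi> v) $ 1 = 0"
      by (rule top_coeff_zero[where \<epsilon> = \<alpha> and \<delta> = 1, OF trans[OF trans[OF _ eq(1)]]]) (simp_all add: \<alpha>)
    moreover have "(B *\<^sub>v \<psi> v) $ 0 = 0"
      by (rule top_coeff_zero[where \<epsilon> = 1 and \<delta> = \<beta>, OF trans[OF trans[OF _ eq(2)]]]) simp_all
    moreover have "(B *\<^sub>v \<psi> v) $ 2 = 0"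
      by (rule top_coeff_zero[where \<epsilon> = \<gamma> and \<delta> = 1, OF trans[OF trans[OF _ eq(3)]]]) (simp_all add: \<gamma>)
    ultimately show ?thesis by (simp add: vec_3_eq_iff)
  qed
  show B: "B = 0\<^sub>m 3 3"
  proof (rule mat_0[where f = \<psi>])
    fix i :: nat assume "i < 3"
    then have "i = 0 \<or> i = 1 \<or> i = 2" by linarith
    moreover have "\<psi> (vec3 0 1 0) = \<alpha> \<cdot>\<^sub>v unit_vec 3 0" "\<psi> (vec3 1 0 0) = 1 \<cdot>\<^sub>v unit_vec 3 1"
        "\<psi> (vec3 0 0 1) = \<gamma> \<cdot>\<^sub>v unit_vec 3 2"
      by (simp_all add: vec_3_eq_iff)
    ultimately show "\<exists>v\<in>F3. \<exists>c. c \<noteq> 0 \<and> \<psi> v = c \<cdot>\<^sub>v unit_vec 3 i"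
      using \<alpha> \<gamma> vec3_in_F3 F_0 F_1 one_neq_zero by metis
  qed (simp_all add: B\<psi>)
  show Xv: "X *\<^sub>v v \<in> F3" if v: "v \<in> F3" for v
    using image(1)[OF v] F3_carrier[OF v] mult_mat_vec_carrier[of X 3 3 v] by (simp add: B zero_mat_mult_vec)
  have blocks: "C *\<^sub>v v = 0\<^sub>v 3" "D *\<^sub>v \<phi> v = \<phi> (X *\<^sub>v v)" "D *\<^sub>v \<psi> v = \<psi> (X *\<^sub>v v)"
    if v: "v \<in> F3" for v
  proof -
    note [simp] = F3_carrier[OF v] mv comb_index comb_carrier
    have coeffs: "(C *\<^sub>v v) $ i = 0" "(D *\<^sub>v \<phi> v) $ i = \<phi> (X *\<^sub>v v) $ i" "(D *\<^sub>v \<psi> v) $ i = \<psi> (X *\<^sub>v v) $ i"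
      if i: "i < 3" for i
    proof -
      have eq: "(C *\<^sub>v v) $ i * t + (D *\<^sub>v \<phi> v) $ i * t ^ (q ^ I) + (D *\<^sub>v \<psi> v) $ i * t ^ (q ^ J) =
          \<phi> (X *\<^sub>v v) $ i * t ^ (q ^ I) + \<psi> (X *\<^sub>v v) $ i * t ^ (q ^ J)" if t: "t \<in> F" for t
      proof -
        have [simp]: "c \<cdot>\<^sub>v 0\<^sub>v 3 + d \<cdot>\<^sub>v 0\<^sub>v 3 = (0\<^sub>v 3 :: 'a vec)" for c d
          by (intro eq_vecI) auto
        have "comb t (C *\<^sub>v v) (D *\<^sub>v \<phi> v) (D *\<^sub>v \<psi> v) =
            t ^ (q ^ I) \<cdot>\<^sub>v \<phi> (X *\<^sub>v v) + t ^ (q ^ J) \<cdot>\<^sub>v \<psi> (X *\<^sub>v v)"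
          using expand[OF v t] by (simp add: comb_def B zero_mat_mult_vec \<phi>_smult \<psi>_smult)
        from arg_cong[OF this, of "\<lambda>w. w $ i"] show ?thesis
          using i by (simp add: mult.commute)
      qed
      show "(C *\<^sub>v v) $ i = 0" "(D *\<^sub>v \<phi> v) $ i = \<phi> (X *\<^sub>v v) $ i" "(D *\<^sub>v \<psi> v) $ i = \<psi> (X *\<^sub>v v) $ i"
        using coeffs_eq[OF eq] by simp_all
    qed
    show "C *\<^sub>v v = 0\<^sub>v 3" "D *\<^sub>v \<phi> v = \<phi> (X *\<^sub>v v)" "D *\<^sub>v \<psi> v = \<psi> (X *\<^sub>v v)"
      using coeffs by (simp_all add: vec_3_eq_iff)
  qed
  show "D *\<^sub>v \<phi> v = \<phi> (X *\<^sub>v v)" "D *\<^sub>v \<psi> v = \<psi> (X *\<^sub>v v)" if "v \<in> F3"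
    using blocks that by blast+
  show "C = 0\<^sub>m 3 3"
  proof (rule mat_0[where f = "\<lambda>v. v"])
    fix i :: nat assume "i < 3"
    then show "\<exists>v\<in>F3. \<exists>c. c \<noteq> 0 \<and> v = c \<cdot>\<^sub>v unit_vec 3 i"
      by (intro bexI[of _ "unit_vec 3 i"] exI[of _ 1]) (auto simp: F3_def unit_vec_def)
  qed (simp_all add: blocks)
qed

text \<open>
  A line spanned by a fixed vector \<open>u\<close> of such an \<open>X\<close> is stable under the semilinear map
  \<open>\<phi>\<^sup>-\<^sup>1 \<circ> \<psi>\<close>, because \<open>\<psi> u = \<psi> (X u) = Y (\<psi> u) = \<phi> (X w)\<close> for the \<open>w\<close> with \<open>\<phi> w = \<psi> u\<close>.
\<close>
lemma no_rank_1_endomorphism: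
  assumes X: "X \<in> carrier_mat 3 3" and idem: "X * X = X"
    and XF: "\<And>v. v \<in> F3 \<Longrightarrow> X *\<^sub>v v \<in> F3"
    and X\<phi>: "\<And>v. v \<in> F3 \<Longrightarrow> Y *\<^sub>v \<phi> v = \<phi> (X *\<^sub>v v)"
    and X\<psi>: "\<And>v. v \<in> F3 \<Longrightarrow> Y *\<^sub>v \<psi> v = \<psi> (X *\<^sub>v v)"
    and rank: "\<forall>v\<in>carrier_vec 3. \<forall>w\<in>carrier_vec 3.
      \<exists>a b. (a \<noteq> 0 \<or> b \<noteq> 0) \<and> a \<cdot>\<^sub>v (X *\<^sub>v v) + b \<cdot>\<^sub>v (X *\<^sub>v w) = 0\<^sub>v 3"
    and v: "v \<in> F3"
  shows "X *\<^sub>v v = 0\<^sub>v 3"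
proof (rule ccontr)
  assume nz: "X *\<^sub>v v \<noteq> 0\<^sub>v 3"
  define u where "u = X *\<^sub>v v"
  have u: "u \<in> F3" using XF v by (simp add: u_def)
  have [simp]: "u \<in> carrier_vec 3" "dim_vec u = 3" using F3_carrier[OF u] by auto
  have "X *\<^sub>v u = u"
    unfolding u_def using assoc_mult_mat_vec[OF X X F3_carrier[OF v]] idem by simp
  then have Yu: "Y *\<^sub>v \<psi> u = \<psi> u" using X\<psi>[OF u] by simp
  obtain w where w: "w \<in> F3" "\<phi> w = \<psi> u" using \<phi>_surj[OF \<psi>_in_F3[OF u]] by blast
  define x where "x = X *\<^sub>v w"
  have x: "x \<in> F3" using XF w by (simp add: x_def)
  have [simp]: "x \<in> carrier_vec 3" "dim_vec x = 3" using F3_carrier[OF x] by auto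
  have \<phi>x: "\<phi> x = \<psi> u"
    using X\<phi>[OF w(1)] w(2) Yu by (simp add: x_def)
  \<comment> \<open>The rank bound, applied to \<open>w\<close> and \<open>v\<close>, makes
    \<open>X w\<close> and \<open>u\<close> dependent.\<close>
  obtain a b where ab: "a \<noteq> 0 \<or> b \<noteq> 0" "a \<cdot>\<^sub>v x + b \<cdot>\<^sub>v u = 0\<^sub>v 3"
    using rank w v F3_carrier unfolding u_def x_def by blast
  obtain i where i: "i < 3" "u $ i \<noteq> 0"
    using nz unfolding u_def[symmetric] by (auto simp: vec_eq_iff dest: carrier_vecD)
  have comp: "a * x $ j + b * u $ j = 0" if "j < 3" for j
    using arg_cong[OF ab(2), of "\<lambda>w. w $ j"] that by simp
  have "a \<noteq> 0" using ab(1) comp[OF i(1)] i(2) by auto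
  \<comment> \<open>\<open>a\<close> and \<open>b\<close> come from the whole algebraically closed
    field; the quotient of entries shows that the ratio lies in \<open>F\<close>.\<close>
  define \<nu> where "\<nu> = x $ i / u $ i"
  have \<nu>_F: "\<nu> \<in> F" using x u i by (auto simp: \<nu>_def F3_def intro: F_divide)
  have \<nu>: "\<nu> = - b / a"
    using comp[OF i(1)] \<open>a \<noteq> 0\<close> i(2) by (simp add: \<nu>_def field_simps add_eq_0_iff)
  have "x = \<nu> \<cdot>\<^sub>v u"
  proof (rule eq_vecI)
    fix j assume "j < dim_vec (\<nu> \<cdot>\<^sub>v u)"
    then have j: "j < 3" by simp
    show "x $ j = (\<nu> \<cdot>\<^sub>v u) $ j"
      using comp[OF j] \<open>a \<noteq> 0\<close> j by (simp add: \<nu> field_simps add_eq_0_iff)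
  qed simp
  \<comment> \<open>This is the stable line, with \<open>\<mu> = \<nu> ^ (q ^ I)\<close>.\<close>
  then have eq: "\<nu> ^ (q ^ I) \<cdot>\<^sub>v \<phi> u = \<psi> u" using \<phi>x by (simp add: \<phi>_smult)
  have "u $ 0 = 0 \<and> u $ 1 = 0 \<and> u $ 2 = 0"
    using arg_cong[OF eq, of "\<lambda>w. w $ 0"] arg_cong[OF eq, of "\<lambda>w. w $ 1"] arg_cong[OF eq, of "\<lambda>w. w $ 2"]
      u \<nu>_F by (intro no_common_zero[of _ _ _ "\<nu> ^ (q ^ I)"]) (auto simp: F3_iff GF_power_closed mult_ac)
  then show False using nz by (simp add: u_def[symmetric] vec_3_eq_iff)
qed

text \<open>Enough because \<open>F3\<close> contains the unit vectors.\<close>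

lemma mat_eqI_on_F3:
  assumes "X \<in> carrier_mat 3 3" "Y \<in> carrier_mat 3 3" "\<And>v. v \<in> F3 \<Longrightarrow> X *\<^sub>v v = Y *\<^sub>v v"
  shows "X = Y"
proof (rule eq_matI)
  fix i j assume ij: "i < dim_row Y" "j < dim_col Y"
  then have "unit_vec 3 j \<in> F3" using assms(2) by (auto simp: F3_def unit_vec_def)
  then have "(X *\<^sub>v unit_vec 3 j) $ i = (Y *\<^sub>v unit_vec 3 j) $ i" using assms(3) by simp
  then show "X $$ (i, j) = Y $$ (i, j)" using assms(1,2) ij by simp
qed (use assms in auto)

text \<open>The upper block \<open>X\<close> is again idempotent, so \<open>X\<close> or
  \<open>1 - X\<close> has rank at most one and therefore vanishes by
  \<open>no_rank_1_endomorphism\<close>. The lower block follows, since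
  \<open>Y \<phi> = \<phi> X\<close> with \<open>\<phi>\<close> onto \<open>F3\<close>.\<close>

lemma idempotent_trivial:
  assumes P: "P \<in> carrier_mat 6 6" and idem: "P * P = P"
    and stable: "\<And>u. u \<in> U \<Longrightarrow> P *\<^sub>v u \<in> U"
  shows "P = 0\<^sub>m 6 6 \<or> P = 1\<^sub>m 6"
proof -
  obtain X B C Y where split: "split_block P 3 3 = (X, B, C, Y)" by (metis prod_cases4)
  have dims [simp]: "X \<in> carrier_mat 3 3" "B \<in> carrier_mat 3 3" "C \<in> carrier_mat 3 3" "Y \<in> carrier_mat 3 3"
    and P_eq: "P = four_block_mat X B C Y"
    using split_block[OF split, of 3 3] P by auto
  have BC: "B = 0\<^sub>m 3 3" "C = 0\<^sub>m 3 3" 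
    and XF: "\<And>v. v \<in> F3 \<Longrightarrow> X *\<^sub>v v \<in> F3"
    and X\<phi>: "\<And>v. v \<in> F3 \<Longrightarrow> Y *\<^sub>v \<phi> v = \<phi> (X *\<^sub>v v)"
    and X\<psi>: "\<And>v. v \<in> F3 \<Longrightarrow> Y *\<^sub>v \<psi> v = \<psi> (X *\<^sub>v v)"
    using endomorphism_blocks[OF dims stable[unfolded P_eq]] by simp_all
  have "P * P = four_block_mat (X * X + B * C) (X * B + B * Y) (C * X + Y * C) (C * B + Y * Y)"
    unfolding P_eq by (rule mult_four_block_mat[OF dims dims])
  then have "four_block_mat (X * X + B * C) (X * B + B * Y) (C * X + Y * C) (C * B + Y * Y) =
      four_block_mat X B C Y"
    using idem P_eq by metis
  moreover have "X * X + B * C = X * X"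
    using right_add_zero_mat[OF mult_carrier_mat[OF dims(1,1)]] by (simp add: BC)
  ultimately have four: "four_block_mat (X * X) (X * B + B * Y) (C * X + Y * C) (C * B + Y * Y) =
      four_block_mat X B C Y"
    by simp
  have X_idem: "X * X = X"
  proof (rule eq_matI)
    fix i j assume "i < dim_row X" "j < dim_col X"
    then show "(X * X) $$ (i, j) = X $$ (i, j)"
      using arg_cong[OF four, of "\<lambda>M. M $$ (i, j)"] carrier_matD[OF dims(1)]
        carrier_matD[OF dims(4)] by simp
  qed (use carrier_matD[OF dims(1)] in simp_all)
  have Y_0: "Y = 0\<^sub>m 3 3" if "X = 0\<^sub>m 3 3"
  proof (rule mat_eqI_on_F3)
    fix w assume w: "w \<in> F3"
    then obtain v where v: "v \<in> F3" "\<phi> v = w" using \<phi>_surj by blast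
    have "\<phi> (0\<^sub>v 3) = 0\<^sub>v 3" by (simp add: vec_3_eq_iff)
    then show "Y *\<^sub>v w = 0\<^sub>m 3 3 *\<^sub>v w"
      using X\<phi>[OF v(1)] v F3_carrier[OF v(1)] F3_carrier[OF w] by (simp add: that zero_mat_mult_vec)
  qed simp_all
  have Y_1: "Y = 1\<^sub>m 3" if "X = 1\<^sub>m 3"
  proof (rule mat_eqI_on_F3)
    fix w assume w: "w \<in> F3"
    then obtain v where v: "v \<in> F3" "\<phi> v = w" using \<phi>_surj by blast
    then show "Y *\<^sub>v w = 1\<^sub>m 3 *\<^sub>v w"
      using X\<phi>[OF v(1)] F3_carrier[OF v(1)] F3_carrier[OF w] by (simp add: that)
  qed simp_all
  define X' where "X' = 1\<^sub>m 3 - X"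
  have X' [simp]: "X' \<in> carrier_mat 3 3" by (simp add: X'_def minus_carrier_mat)
  have mv: "(1\<^sub>m 3 - M) *\<^sub>v v = v - M *\<^sub>v v" if "M \<in> carrier_mat 3 3" "v \<in> carrier_vec 3" for M :: "'a mat" and v
    using minus_mult_distrib_mat_vec[OF one_carrier_mat that] that by simp
  from idempotent_3_cases[OF dims(1) X_idem]
  consider "\<forall>v\<in>carrier_vec 3. \<forall>w\<in>carrier_vec 3.
      \<exists>a b. (a \<noteq> 0 \<or> b \<noteq> 0) \<and> a \<cdot>\<^sub>v (X *\<^sub>v v) + b \<cdot>\<^sub>v (X *\<^sub>v w) = 0\<^sub>v 3"
    | "\<forall>v\<in>carrier_vec 3. \<forall>w\<in>carrier_vec 3.
      \<exists>a b. (a \<noteq> 0 \<or> b \<noteq> 0) \<and> a \<cdot>\<^sub>v (X' *\<^sub>v v) + b \<cdot>\<^sub>v (X' *\<^sub>v w) = 0\<^sub>v 3"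
    unfolding X'_def by blast
  then show ?thesis
  proof cases
    case 1
    have X0: "X = 0\<^sub>m 3 3"
    proof (rule mat_eqI_on_F3)
      fix v assume v: "v \<in> F3"
      show "X *\<^sub>v v = 0\<^sub>m 3 3 *\<^sub>v v"
        using no_rank_1_endomorphism[OF dims(1) X_idem XF X\<phi> X\<psi> 1 v] F3_carrier[OF v]
        by (simp add: zero_mat_mult_vec)
    qed simp_all
    show ?thesis
      unfolding P_eq BC X0 Y_0[OF X0] by (auto intro!: disjI1 eq_matI)
  next
    case 2
    have X1: "X = 1\<^sub>m 3"
    proof (rule mat_eqI_on_F3)
      fix v assume v: "v \<in> F3"
      have "X' *\<^sub>v v = 0\<^sub>v 3"
      \<comment> \<open>Since \<open>\<phi>\<close> and \<open>\<psi>\<close> are additive, the pair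
        \<open>1 - X\<close>, \<open>1 - Y\<close> inherits the commutation relations.\<close>
      proof (rule no_rank_1_endomorphism[of X' "1\<^sub>m 3 - Y"])
        show "X' * X' = X'" unfolding X'_def by (rule diff_idempotent[OF dims(1) X_idem])
      next
        fix v assume v: "v \<in> F3"
        note [simp] = F3_carrier[OF v] mult_mat_vec_carrier[OF dims(1)]
        show "X' *\<^sub>v v \<in> F3" by (simp add: mv X'_def XF F3_diff v)
        show "(1\<^sub>m 3 - Y) *\<^sub>v \<phi> v = \<phi> (X' *\<^sub>v v)" "(1\<^sub>m 3 - Y) *\<^sub>v \<psi> v = \<psi> (X' *\<^sub>v v)"
          by (simp_all add: mv X'_def \<phi>_diff \<psi>_diff X\<phi> X\<psi> v)
      qed (use 2 v in auto)
      then have "v - X *\<^sub>v v = 0\<^sub>v 3" unfolding X'_def using mv F3_carrier[OF v] by simp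
      then show "X *\<^sub>v v = 1\<^sub>m 3 *\<^sub>v v"
        using F3_carrier[OF v] mult_mat_vec_carrier[OF dims(1) F3_carrier[OF v]]
          carrier_matD[OF dims(1)] by (simp add: vec_3_eq_iff)
    qed simp_all
    show ?thesis
      unfolding P_eq BC X1 Y_1[OF X1] by (auto intro!: disjI2 eq_matI)
  qed
qed

subsection \<open>Scatteredness and indecomposability\<close>

lemma \<phi>_add: "v \<in> carrier_vec 3 \<Longrightarrow> w \<in> carrier_vec 3 \<Longrightarrow> \<phi> (v + w) = \<phi> v + \<phi> w"
  by (subst vec_3_eq_iff) (simp_all add: frob_add distrib_left)

lemma \<psi>_add: "v \<in> carrier_vec 3 \<Longrightarrow> w \<in> carrier_vec 3 \<Longrightarrow> \<psi> (v + w) = \<psi> v + \<psi> w"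
  by (subst vec_3_eq_iff) (simp_all add: frob_add distrib_left)

lemma F3_add: "v \<in> F3 \<Longrightarrow> w \<in> F3 \<Longrightarrow> v + w \<in> F3"
  by (auto simp: F3_iff F_add)

lemma \<phi>\<psi>_in_F3: "v \<in> F3 \<Longrightarrow> \<phi> v + \<psi> v \<in> F3"
  using \<alpha> \<beta> \<gamma> by (intro F3_add \<psi>_in_F3) (auto simp: F3_iff intro: GF_mult_closed GF_power_closed)

section \<open>The ambient space over the small and the big field\<close>

definition V :: "('a, 'a vec) module" where
  "V = GF_vec (q ^ N) 6"

lemma carrier_V: "carrier V = {v \<in> carrier_vec 6. \<forall>i<6. v $ i \<in> F}"
  and V_simps [simp]: "\<zero>\<^bsub>V\<^esub> = 0\<^sub>v 6" "add V = (+)" "module.smult V = (\<cdot>\<^sub>v)"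
  by (simp_all add: V_def GF_vec_def module_vec_def)

lemma finite_carrier_V: "finite (carrier V)"
proof (rule finite_subset)
  show "carrier V \<subseteq> vec_of_list ` {xs. set xs \<subseteq> F \<and> length xs = 6}"
  proof
    fix v assume "v \<in> carrier V"
    then have "set (list_of_vec v) \<subseteq> F" "length (list_of_vec v) = 6" "v = vec_of_list (list_of_vec v)"
      by (auto simp: carrier_V in_set_conv_nth list_of_vec_index vec_list)
    then show "v \<in> vec_of_list ` {xs. set xs \<subseteq> F \<and> length xs = 6}" by blast
  qed
  show "finite (vec_of_list ` {xs. set xs \<subseteq> F \<and> length xs = 6})"
    by (intro finite_imageI finite_lists_length_eq finite_F)
qed

lemma vectorspace_q: "vectorspace (GF_ring q) V"
  using vectorspace_GF_vec[OF p char_p e N_pos, of 6, folded q_def] by (simp add: V_def)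

lemma vectorspace_F: "vectorspace (GF_ring (q ^ N)) V"
  using vectorspace_GF_vec[OF p char_p, of "e * N" 1 6] e N_pos by (simp add: V_def q_power)

lemma subspace_iff:
  assumes "vectorspace k V"
  shows "VectorSpace.subspace k W V \<longleftrightarrow> W \<subseteq> carrier V \<and> 0\<^sub>v 6 \<in> W \<and>
    (\<forall>v\<in>W. \<forall>w\<in>W. v + w \<in> W) \<and> (\<forall>c\<in>carrier k. \<forall>v\<in>W. c \<cdot>\<^sub>v v \<in> W)"
proof -
  interpret vectorspace k V by fact
  have "module k V" ..
  then show ?thesis
    using assms by (auto simp: VectorSpace.subspace_def submodule_def)
qed

lemma GF_q_frob: "c \<in> GF q \<Longrightarrow> c ^ (q ^ k) = c"
  using GF_mono[of q k] by (auto simp: GF_def)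

lemma GF_q_subset: "GF q \<subseteq> F"
  by (rule GF_mono)

lemma subspace_U: "VectorSpace.subspace (GF_ring q) U V"
  unfolding subspace_iff[OF vectorspace_q]
proof (intro conjI ballI)
  show "U \<subseteq> carrier V"
  proof
    fix u assume "u \<in> U"
    then obtain v where v: "v \<in> F3" and u: "u = v @\<^sub>v (\<phi> v + \<psi> v)" by (auto simp: U_eq)
    define w where "w = \<phi> v + \<psi> v"
    have "w \<in> F3" unfolding w_def using v by (rule \<phi>\<psi>_in_F3)
    then show "u \<in> carrier V"
      using v append_carrier_vec[of v 3 w 3] unfolding u w_def[symmetric] by (auto simp: carrier_V F3_def)
  qed
  have "\<phi> (0\<^sub>v 3) + \<psi> (0\<^sub>v 3) = 0\<^sub>v 3" "0\<^sub>v 6 = 0\<^sub>v 3 @\<^sub>v 0\<^sub>v 3"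
    by (simp_all add: vec_3_eq_iff zero_vec_append)
  moreover have "0\<^sub>v 3 \<in> F3" by (simp add: F3_iff)
  ultimately show "0\<^sub>v 6 \<in> U" by (auto simp: U_eq intro!: exI[of _ "0\<^sub>v 3"])
next
  fix u u' assume "u \<in> U" "u' \<in> U"
  then obtain v v' where v: "v \<in> F3" "u = v @\<^sub>v (\<phi> v + \<psi> v)" "v' \<in> F3" "u' = v' @\<^sub>v (\<phi> v' + \<psi> v')"
    by (auto simp: U_eq)
  note [simp] = F3_carrier[OF v(1)] F3_carrier[OF v(3)]
  have "(\<phi> v + \<psi> v) + (\<phi> v' + \<psi> v') = \<phi> (v + v') + \<psi> (v + v')"
    by (simp add: vec_3_eq_iff \<phi>_add \<psi>_add)
  then have "u + u' = (v + v') @\<^sub>v (\<phi> (v + v') + \<psi> (v + v'))"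
    unfolding v by (subst append_vec_add[of _ 3 _ _ 3]) simp_all
  then show "u + u' \<in> U" using F3_add[OF v(1,3)] by (auto simp: U_eq)
next
  fix c :: 'a and u assume c: "c \<in> carrier (GF_ring q)" and "u \<in> U"
  then obtain v where v: "v \<in> F3" "u = v @\<^sub>v (\<phi> v + \<psi> v)" by (auto simp: U_eq)
  note [simp] = F3_carrier[OF v(1)]
  \<comment> \<open>Elements of \<open>GF q\<close> are fixed by all powers \<open>q ^ k\<close>, so
    both semilinear maps are linear over \<open>GF q\<close>.\<close>
  have "c \<cdot>\<^sub>v (\<phi> v + \<psi> v) = \<phi> (c \<cdot>\<^sub>v v) + \<psi> (c \<cdot>\<^sub>v v)"
    using c GF_q_frob[of c] by (simp add: \<phi>_smult \<psi>_smult smult_add_distrib_vec[of _ 3])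
  then have "c \<cdot>\<^sub>v u = (c \<cdot>\<^sub>v v) @\<^sub>v (\<phi> (c \<cdot>\<^sub>v v) + \<psi> (c \<cdot>\<^sub>v v))"
    unfolding v by (simp add: append_vec_smult)
  then show "c \<cdot>\<^sub>v u \<in> U" using F3_smult[OF _ v(1)] c GF_q_subset by (auto simp: U_eq)
qed

text \<open>The upper halves show that \<open>c \<cdot>\<^sub>v u\<close> comes from
  \<open>c \<cdot>\<^sub>v v\<close>; the lower halves then are the equations of
  \<open>scalar_in_GF_q\<close>.\<close>

lemma scalar_of_U_in_GF_q:
  assumes u: "u \<in> U" "u \<noteq> 0\<^sub>v 6" and c: "c \<in> F" "c \<cdot>\<^sub>v u \<in> U"
  shows "c \<in> GF q"
proof -
  obtain v where v: "v \<in> F3" "u = v @\<^sub>v (\<phi> v + \<psi> v)" using u(1) by (auto simp: U_eq)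
  obtain w where w: "w \<in> F3" "c \<cdot>\<^sub>v u = w @\<^sub>v (\<phi> w + \<psi> w)" using c(2) by (auto simp: U_eq)
  have [simp]: "v \<in> carrier_vec 3" "dim_vec v = 3" using F3_carrier[OF v(1)] by auto
  have "(c \<cdot>\<^sub>v v) @\<^sub>v (c \<cdot>\<^sub>v (\<phi> v + \<psi> v)) = w @\<^sub>v (\<phi> w + \<psi> w)"
    using w(2) by (simp add: v(2) append_vec_smult)
  then have "w = c \<cdot>\<^sub>v v" "c \<cdot>\<^sub>v (\<phi> v + \<psi> v) = \<phi> w + \<psi> w"
    using append_vec_eq[of "c \<cdot>\<^sub>v v" 3 w] F3_carrier[OF w(1)] by auto
  then have eq: "c \<cdot>\<^sub>v (\<phi> v + \<psi> v) = \<phi> (c \<cdot>\<^sub>v v) + \<psi> (c \<cdot>\<^sub>v v)" by simp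
  have nz: "\<not> (v $ 0 = 0 \<and> v $ 1 = 0 \<and> v $ 2 = 0)"
  proof
    assume "v $ 0 = 0 \<and> v $ 1 = 0 \<and> v $ 2 = 0"
    then have "v = 0\<^sub>v 3" "\<phi> v + \<psi> v = 0\<^sub>v 3" by (simp_all add: vec_3_eq_iff)
    then have "u = 0\<^sub>v 3 @\<^sub>v 0\<^sub>v 3" unfolding v by simp
    then show False using u(2) by (simp add: zero_vec_append)
  qed
  show ?thesis
    using eq v(1)
    by (intro scalar_in_GF_q[OF _ _ _ c(1) nz]) (auto simp: vec_3_eq_iff F3_iff algebra_simps)
qed

lemma scattered_U: "scattered (GF_ring q) (GF_ring (q ^ N)) V U"
  unfolding scattered_def
proof (intro conjI subspace_U allI impI)
  fix L assume "VectorSpace.subspace (GF_ring (q ^ N)) L V \<and>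
    vectorspace.dim (GF_ring (q ^ N)) (V\<lparr>carrier := L\<rparr>) = 1"
  then have L: "VectorSpace.subspace (GF_ring (q ^ N)) L V"
    and dim: "vectorspace.dim (GF_ring (q ^ N)) (V\<lparr>carrier := L\<rparr>) = 1" by auto
  note L' = L[unfolded subspace_iff[OF vectorspace_F]]
  note U' = subspace_U[unfolded subspace_iff[OF vectorspace_q]]
  have L_sub: "L \<subseteq> carrier V" and L_zero: "0\<^sub>v 6 \<in> L"
    and L_add: "\<And>v w. v \<in> L \<Longrightarrow> w \<in> L \<Longrightarrow> v + w \<in> L"
    and L_smult: "\<And>c v. c \<in> F \<Longrightarrow> v \<in> L \<Longrightarrow> c \<cdot>\<^sub>v v \<in> L"
    using L unfolding subspace_iff[OF vectorspace_F] by auto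
  have U_zero: "0\<^sub>v 6 \<in> U"
    using subspace_U unfolding subspace_iff[OF vectorspace_q] by blast
  have "finite L" by (rule finite_subset[OF L_sub finite_carrier_V])
  \<comment> \<open>\<open>g\<close> spans the line over the big field but need not lie in
    \<open>U\<close>.\<close>
  then obtain g where g: "g \<in> L" "\<And>w. w \<in> L \<Longrightarrow> \<exists>c\<in>F. w = c \<cdot>\<^sub>v g"
    using dim_1_generator[OF vectorspace.subspace_is_vs[OF vectorspace_F L] _ dim] by simp metis
  have UL: "VectorSpace.subspace (GF_ring q) (U \<inter> L) V"
    using subspace_U L_sub L_zero L_add L_smult subsetD[OF GF_q_subset]
    unfolding subspace_iff[OF vectorspace_q] by simp blast
  \<comment> \<open>A nonzero vector of the intersection if there is one, and the zero vector
    otherwise; it will generate the intersection over \<open>GF q\<close>.\<close>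
  obtain u where u: "u \<in> U \<inter> L" "U \<inter> L \<noteq> {0\<^sub>v 6} \<Longrightarrow> u \<noteq> 0\<^sub>v 6"
  proof (cases "U \<inter> L = {0\<^sub>v 6}")
    case True
    then show thesis by (intro that[of "0\<^sub>v 6"]) auto
  next
    case False
    then obtain u where "u \<in> U \<inter> L" "u \<noteq> 0\<^sub>v 6" using U_zero L_zero by blast
    then show thesis by (intro that[of u]) auto
  qed
  have "\<exists>c\<in>GF q. w = c \<cdot>\<^sub>v u" if w: "w \<in> U \<inter> L" for w
  proof (cases "u = 0\<^sub>v 6")
    case True
    then have "w = 0\<^sub>v 6" using u w by blast
    then show ?thesis using True q_gt_1 by (intro bexI[of _ 0]) (auto simp: GF_def)
  next
    case False
    obtain a b where ab: "a \<in> F" "b \<in> F" "u = a \<cdot>\<^sub>v g" "w = b \<cdot>\<^sub>v g"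
      using g(2)[of u] g(2)[of w] u(1) w by blast
    have "g \<in> carrier_vec 6" using g(1) L_sub by (auto simp: carrier_V)
    then have "0 \<cdot>\<^sub>v g = 0\<^sub>v 6" by (intro eq_vecI) auto
    then have "a \<noteq> 0" using False ab(3) by auto
    then have eq: "w = (b / a) \<cdot>\<^sub>v u" by (simp add: ab smult_smult_assoc)
    have "b / a \<in> GF q"
      using scalar_of_U_in_GF_q[OF _ False, of "b / a"] u w ab eq by (simp add: F_divide)
    then show ?thesis using eq by blast
  qed
  then show "vectorspace.dim (GF_ring q) (V\<lparr>carrier := U \<inter> L\<rparr>) \<le> 1"
    using u by (intro dim_le_1_if_generated[OF vectorspace.subspace_is_vs[OF vectorspace_q UL], of u]) auto
qed

text \<open>Written entrywise to match the product of a vector with a matrix whose columns lie in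
  \<open>W\<close>.\<close>

lemma combination_in_subspace:
  fixes k :: nat
  assumes W: "VectorSpace.subspace (GF_ring (q ^ N)) W V"
    and a: "\<And>j. j < k \<Longrightarrow> a j \<in> W" and c: "\<And>j. j < k \<Longrightarrow> c j \<in> F"
  shows "vec 6 (\<lambda>i. \<Sum>j<k. c j * a j $ i) \<in> W"
  using a c
proof (induction k)
  case 0
  have "vec 6 (\<lambda>i. 0) = (0\<^sub>v 6 :: 'a vec)" by auto
  then show ?case using W by (simp add: subspace_iff[OF vectorspace_F])
next
  case (Suc k)
  have "a k \<in> carrier_vec 6" using W Suc.prems by (auto simp: subspace_iff[OF vectorspace_F] carrier_V)
  then have "vec 6 (\<lambda>i. \<Sum>j<Suc k. c j * a j $ i) = vec 6 (\<lambda>i. \<Sum>j<k. c j * a j $ i) + c k \<cdot>\<^sub>v a k"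
    by (intro eq_vecI) auto
  then show ?case using W Suc by (auto simp: subspace_iff[OF vectorspace_F])
qed

text \<open>The projection onto \<open>V1\<close> along \<open>V2\<close> preserves
  \<open>U\<close>, so by \<open>idempotent_trivial\<close> it is \<open>0\<close> or
  \<open>1\<close>, and \<open>V1\<close> or \<open>V2\<close> is trivial.\<close>

lemma indecomposable_U: "indecomposable (GF_ring (q ^ N)) V U"
proof
  assume "decomposable (GF_ring (q ^ N)) V U"
  then obtain V1 V2 where sub1: "VectorSpace.subspace (GF_ring (q ^ N)) V1 V"
    and sub2: "VectorSpace.subspace (GF_ring (q ^ N)) V2 V"
    and nz: "V1 \<noteq> {0\<^sub>v 6}" "V2 \<noteq> {0\<^sub>v 6}" and Int: "V1 \<inter> V2 = {0\<^sub>v 6}"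
    and sum: "V1 <+>\<^bsub>V\<^esub> V2 = carrier V" and U_sum: "(U \<inter> V1) <+>\<^bsub>V\<^esub> (U \<inter> V2) = U"
    by (auto simp: decomposable_def)
  note V12 = sub1[unfolded subspace_iff[OF vectorspace_F]] sub2[unfolded subspace_iff[OF vectorspace_F]]
  have car: "v \<in> carrier_vec 6" if "v \<in> carrier V" for v using that by (simp add: carrier_V)
  have car12: "v \<in> carrier_vec 6" if "v \<in> V1 \<or> v \<in> V2" for v using that V12 car by blast
  have diff: "v - w \<in> W" 
    if W: "VectorSpace.subspace (GF_ring (q ^ N)) W V" and vw: "v \<in> W" "w \<in> W" for v w W
  proof -
    have "v + (- 1) \<cdot>\<^sub>v w \<in> W"
      using W vw F_minus[OF F_1] by (auto simp: subspace_iff[OF vectorspace_F])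
    moreover have "v \<in> carrier_vec 6" "w \<in> carrier_vec 6"
      using W vw car by (auto simp: subspace_iff[OF vectorspace_F])
    then have "v + (- 1) \<cdot>\<^sub>v w = v - w" by (intro eq_vecI) auto
    ultimately show ?thesis by simp
  qed
  have "\<exists>a b. a \<in> V1 \<and> b \<in> V2 \<and> unit_vec 6 j = a + b" if "j < 6" for j
  proof -
    have "unit_vec 6 j \<in> V1 <+>\<^bsub>V\<^esub> V2"
      unfolding sum using that by (auto simp: carrier_V unit_vec_def)
    then show ?thesis by (auto simp: set_add_defs)
  qed
  then obtain a b where ab: "\<And>j. j < 6 \<Longrightarrow> a j \<in> V1" "\<And>j. j < 6 \<Longrightarrow> b j \<in> V2"
      "\<And>j. j < 6 \<Longrightarrow> unit_vec 6 j = a j + b j"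
    by metis
  \<comment> \<open>The columns of the projection are the \<open>V1\<close>-components of the unit
    vectors; the \<open>b j\<close> form the complementary projection.\<close>
  define P where "P = mat 6 6 (\<lambda>(i, j). a j $ i)"
  have P [simp]: "P \<in> carrier_mat 6 6" "dim_row P = 6" "dim_col P = 6" by (simp_all add: P_def)
  have PV1: "P *\<^sub>v v \<in> V1" and PV2: "v - P *\<^sub>v v \<in> V2" if v: "v \<in> carrier V" for v
  proof -
    have [simp]: "dim_vec v = 6" using car[OF v] by auto
    have P_v: "P *\<^sub>v v = vec 6 (\<lambda>i. \<Sum>j<6. v $ j * a j $ i)"
      by (intro eq_vecI) (simp_all add: P_def scalar_prod_def atLeast0LessThan mult.commute)
    then show "P *\<^sub>v v \<in> V1"
      using combination_in_subspace[OF sub1, of 6 a "\<lambda>j. v $ j"] ab v by (simp add: carrier_V)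
    have "v - P *\<^sub>v v = vec 6 (\<lambda>i. \<Sum>j<6. v $ j * b j $ i)"
    proof (intro eq_vecI)
      fix i assume "i < dim_vec (vec 6 (\<lambda>i. \<Sum>j<6. v $ j * b j $ i))"
      then have i: "i < 6" by simp
      have "b j $ i = (if i = j then 1 else 0) - a j $ i" if "j < 6" for j
      proof -
        have "a j \<in> carrier_vec 6" "b j \<in> carrier_vec 6" using car12 ab that by blast+
        then have "a j $ i + b j $ i = unit_vec 6 j $ i" unfolding ab(3)[OF that] using i by simp
        then show ?thesis using i that by (simp add: algebra_simps)
      qed
      then have "(\<Sum>j<6. v $ j * b j $ i) = (\<Sum>j<6. (if i = j then v $ j else 0) - v $ j * a j $ i)"
        by (intro sum.cong) (auto simp: right_diff_distrib)
      also have "\<dots> = v $ i - (\<Sum>j<6. v $ j * a j $ i)"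
        using i by (simp add: sum_subtractf)
      finally show "(v - P *\<^sub>v v) $ i = vec 6 (\<lambda>i. \<Sum>j<6. v $ j * b j $ i) $ i"
        using i by (simp add: P_v)
    qed simp
    then show "v - P *\<^sub>v v \<in> V2"
      using combination_in_subspace[OF sub2, of 6 b "\<lambda>j. v $ j"] ab v by (simp add: carrier_V)
  qed
  have P1: "P *\<^sub>v v = v" if v: "v \<in> V1" for v
  proof -
    have vV: "v \<in> carrier V" using v V12 by blast
    have "v - P *\<^sub>v v \<in> V1 \<inter> V2" using diff[OF sub1 v] PV1[OF vV] PV2[OF vV] by blast
    then have z: "v - P *\<^sub>v v = 0\<^sub>v 6" using Int by simp
    show ?thesis
    proof (rule eq_vecI)
      fix i assume "i < dim_vec v"
      then show "(P *\<^sub>v v) $ i = v $ i" using arg_cong[OF z, of "\<lambda>w. w $ i"] car[OF vV] by simp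
    qed (use car[OF vV] in simp)
  qed
  have P2: "P *\<^sub>v v = 0\<^sub>v 6" if v: "v \<in> V2" for v
  proof -
    have vV: "v \<in> carrier V" using v V12 by blast
    have "v - (v - P *\<^sub>v v) \<in> V2" using diff[OF sub2 v PV2[OF vV]] .
    moreover have "v - (v - P *\<^sub>v v) = P *\<^sub>v v" using car[OF vV] by (intro eq_vecI) auto
    ultimately show ?thesis using PV1[OF vV] Int by auto
  qed
  have "P * P = P"
  proof (rule mat_col_eqI)
    fix j assume j: "j < dim_col P"
    have "a j \<in> V1" using ab j by simp
    moreover have "col P j = a j" using j car12[of "a j"] ab by (intro eq_vecI) (auto simp: P_def)
    moreover have "col (P * P) j = P *\<^sub>v col P j" using j by (intro col_mult2[of _ 6 6 _ 6]) auto
    ultimately show "col (P * P) j = col P j" using P1 by simp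
  qed simp_all
  moreover have "P *\<^sub>v u \<in> U" if "u \<in> U" for u
  proof -
    \<comment> \<open>Both components of \<open>u\<close> lie in \<open>U\<close>, and
      \<open>P\<close> returns the first one.\<close>
    have "u \<in> (U \<inter> V1) <+>\<^bsub>V\<^esub> (U \<inter> V2)" using that U_sum by simp
    then obtain u1 u2 where u: "u1 \<in> U" "u1 \<in> V1" "u2 \<in> V2" "u = u1 + u2" by (auto simp: set_add_defs)
    have "P *\<^sub>v u = P *\<^sub>v u1 + P *\<^sub>v u2"
      unfolding u(4) using car12 u by (intro mult_add_distrib_mat_vec[of _ 6 6]) auto
    then show ?thesis using P1[OF u(2)] P2[OF u(3)] u car12 by simp
  qed
  ultimately consider "P = 0\<^sub>m 6 6" | "P = 1\<^sub>m 6" using idempotent_trivial[OF P(1)] by blast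
  then show False
  proof cases
    case 1
    have "v = 0\<^sub>v 6" if "v \<in> V1" for v
    proof -
      have "v \<in> carrier_vec 6" using car12 that by blast
      then show ?thesis using P1[OF that] 1 by (simp add: zero_mat_mult_vec)
    qed
    then show False using nz(1) V12 by blast
  next
    case 2
    have "v = 0\<^sub>v 6" if "v \<in> V2" for v
      using P2[OF that] car12[of v] that by (simp add: 2)
    then show False using nz(2) V12 by blast
  qed
qed

end

section \<open>Infinitely many suitable \<open>m\<close>\<close>

theorem theorem2p10:
  fixes p e q n I J K A :: nat
    and \<alpha> \<beta> \<gamma> :: "'a :: alg_closed_field"
  assumes "prime p" and "CHAR('a) = p" and "e > 0" and "q = p ^ e"
    and "n > 0" and "0 < I" and "I < J" and "J < n"
    and "K = J - I" and "A = q ^ (2 * K) + q ^ K + 1"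
    and "\<alpha> \<in> GF (q ^ n) - {0}" and "\<beta> \<in> GF (q ^ n) - {0}" and "\<gamma> \<in> GF (q ^ n) - {0}"
    and "Gcd {n, I, J} = 1"
    and "\<not> is_power_in (GF (q ^ n)) A (\<alpha> * \<gamma> ^ (q ^ K) * \<beta> ^ (q ^ K + 1))"
  shows "infinite {m. m > 0 \<and>
    (let F = GF_ring (q ^ (n * m)); V = GF_vec (q ^ (n * m)) 6;
         U = U_set q I J (n * m) \<alpha> \<beta> \<gamma>
     in VectorSpace.subspace (GF_ring q) U V \<and> scattered (GF_ring q) F V U \<and>
        indecomposable F V U)}"
proof -
  define c where "c = \<alpha> * \<gamma> ^ (q ^ K) * \<beta> ^ (q ^ K + 1)"
  have q: "q > 1"
    using one_less_power[OF prime_gt_1_nat[OF assms(1)] assms(3)] assms(4) by simp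
  have "A > 0" using assms(10) by simp
  have c: "c \<in> GF (q ^ n)" "c \<noteq> 0"
    using assms(11-13) by (auto simp: c_def intro!: GF_mult_closed GF_power_closed)
  have good: "VectorSpace.subspace (GF_ring q) (U_set q I J (n * m) \<alpha> \<beta> \<gamma>) (GF_vec (q ^ (n * m)) 6) \<and>
      scattered (GF_ring q) (GF_ring (q ^ (n * m))) (GF_vec (q ^ (n * m)) 6) (U_set q I J (n * m) \<alpha> \<beta> \<gamma>) \<and>
      indecomposable (GF_ring (q ^ (n * m))) (GF_vec (q ^ (n * m)) 6) (U_set q I J (n * m) \<alpha> \<beta> \<gamma>)"
    \<comment> \<open>Being prime to \<open>A\<close> keeps the element a non-power, being prime to
      \<open>I\<close> keeps the gcd equal to 1, and \<open>m > 1\<close> gives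
      \<open>2 * J < n * m\<close>.\<close>
    if m: "m > 1" "coprime m (A * I)" for m
  proof -
    have mono: "GF (q ^ n) \<subseteq> (GF (q ^ (n * m)) :: 'a set)"
      using GF_mono[of "q ^ n" m] by (simp add: power_mult)
    have "gcd (n * m) (gcd I J) = 1"
    proof -
      have "coprime m (gcd I J)"
        using m(2) by (meson coprime_divisors dvd_refl dvd_trans dvd_triv_right gcd_dvd1)
      moreover have "coprime n (gcd I J)"
        using assms(14) by (simp add: coprime_iff_gcd_eq_1)
      ultimately show ?thesis by (simp add: coprime_iff_gcd_eq_1 [symmetric])
    qed
    then have Gcd: "Gcd {n * m, I, J} = 1" by simp
    have "2 * J < n * m"
    proof -
      have "2 * J < n * 2" using assms(8) by simp
      also have "\<dots> \<le> n * m" using m(1) by (intro mult_le_mono2) simp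
      finally show ?thesis .
    qed
    moreover have "\<not> is_power_in (GF (q ^ (n * m))) A c"
      using not_is_power_in_extension[of c "q ^ n" m A] c m assms(15)
      by (simp add: c_def power_mult)
    ultimately interpret triple_family p e q "n * m" I J K A \<alpha> \<beta> \<gamma>
      using assms mono Gcd by unfold_locales (auto simp: c_def)
    show ?thesis
      using subspace_U scattered_U indecomposable_U by (simp add: U_def V_def)
  qed
  \<comment> \<open>Numbers one more than a multiple of \<open>A * I\<close> are prime to it;
    \<open>Suc k\<close> in place of \<open>k\<close> excludes \<open>m = 1\<close>.\<close>
  have "infinite (range (\<lambda>k. Suc (Suc k * (A * I))))"
    using \<open>A > 0\<close> assms(6) by (intro range_inj_infinite injI) simp
  moreover have "range (\<lambda>k. Suc (Suc k * (A * I))) \<subseteq> {m. m > 1 \<and> coprime m (A * I)}"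
  proof (rule image_subsetI, rule CollectI, rule conjI)
    fix k
    show "Suc (Suc k * (A * I)) > 1" using \<open>A > 0\<close> assms(6) by simp
    have "coprime (Suc (Suc k * (A * I))) (Suc k * (A * I))" by (rule coprime_Suc_left_nat)
    then show "coprime (Suc (Suc k * (A * I))) (A * I)"
      by (rule coprime_divisors[OF dvd_refl dvd_triv_right])
  qed
  ultimately have "infinite {m. m > 1 \<and> coprime m (A * I)}"
    using finite_subset by blast
  then show ?thesis
    by (rule infinite_super[rotated]) (use good in \<open>auto simp: Let_def simp del: coprime_mult_right_iff\<close>)
qed

end
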